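(* Let $K$ be a field, $S=K[t_1,\ldots,t_s]$, and let $\mathcal{L}\subset\mathbb{Z}^s$ be a lattice. If the lattice ideal $I(\mathcal{L})\subset S$ has dimension $1$ and is homogeneous with respect to a positive vector $(d_1,\ldots,d_s)$ of integers, then $$\gcd(d_1,\ldots,d_s)\,\deg(S/I(\mathcal{L}))=\max\{d_1,\ldots,d_s\}\,|T(\mathbb{Z}^s/\mathcal{L})|.$$
   Context: A lattice is a subgroup $\mathcal{L}$ of $\mathbb{Z}^s$. For $a\in\mathbb{Z}^s$ write $a=a^+-a^-$ with $a^+,a^-\in\mathbb{N}^s$ of disjoint support, and $t^c=t_1^{c_1}\cdots t_s^{c_s}$. The lattice ideal is $I(\mathcal{L})=(t^{a^+}-t^{a^-}\mid a\in\mathcal{L})\subset S$. The dimension of an ideal $I$ is the Krull dimension of $S/I$. Homogeneous with respect to $(d_1,\ldots,d_s)$ means homogeneous for the grading of $S$ with $\deg t_i=d_i$. $T(M)$ is the torsion subgroup of an abelian group $M$. For an ideal $I\subset S$ with $k=\dim(S/I)$, the degree is $\deg(S/I)=k!\lim_{i\to\infty}\dim_K(S_{\le i}/I_{\le i})/i^k$, where $S_{\le i}$ (resp. $I_{\le i}$) is the space of polynomials of $S$ (resp. of $I$) of standard total degree at most $i$. *)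

theory Defs
  imports
    "HOL-Analysis.Finite_Cartesian_Product"
    "HOL-Library.Poly_Mapping"
    "HOL-Library.Extended_Nat"
    "HOL-Algebra.Algebraic_Closure_Type"
    "Jordan_Normal_Form.Missing_VectorSpace"
begin

no_notation fps_nth (infixl \<open>$\<close> 75)

text \<open>
  The polynomial ring in the variables \<open>t\<^sub>j\<close> (\<open>j :: 's\<close>) over \<open>'k\<close> is the monoid algebra of
  \<open>\<nat>\<^sup>s\<close>: a polynomial is a finitely supported map from exponent vectors to coefficients.
\<close>

type_synonym ('k, 's) mpol = "(nat ^ 's) \<Rightarrow>\<^sub>0 'k"

abbreviation mpol_ring :: "('k::field, 's::finite) mpol ring"
  where "mpol_ring \<equiv> ring_of_type_algebra"

definition monomial :: "nat ^ 's \<Rightarrow> ('k::field, 's::finite) mpol"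
  where "monomial c = Poly_Mapping.single c 1"

lemma monomial_eq_prod_variables:
  "(monomial c :: ('k::field, 's::finite) mpol) = (\<Prod>j\<in>UNIV. monomial (axis j 1) ^ (c $ j))"
proof -
  have pow: "(monomial a :: ('k, 's) mpol) ^ n = monomial (of_nat n * a)" for a n
    by (induction n)
       (simp_all add: monomial_def Poly_Mapping.mult_single distrib_right flip: Poly_Mapping.single_one)
  have prod: "(\<Prod>j\<in>A. monomial (f j)) = (monomial (sum f A) :: ('k, 's) mpol)"
    if "finite A" for A and f :: "'s \<Rightarrow> nat ^ 's"
    using that
    by (induction A)
       (simp_all add: monomial_def Poly_Mapping.mult_single flip: Poly_Mapping.single_one)
  have "(\<Sum>j\<in>UNIV. of_nat (c $ j) * axis j 1) = c"
    by (simp add: vec_eq_iff axis_def of_nat_index if_distrib cong: if_cong)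
  then show ?thesis
    by (simp add: pow prod)
qed


definition int_lattice_group :: "(int ^ 's::finite) monoid"
  where "int_lattice_group = \<lparr>carrier = UNIV, monoid.mult = (+), one = 0\<rparr>"

definition torsion_subgroup :: "('a, 'b) monoid_scheme \<Rightarrow> 'a set"
  where "torsion_subgroup G = {x \<in> carrier G. \<exists>n>0. x [^]\<^bsub>G\<^esub> (n::nat) = \<one>\<^bsub>G\<^esub>}"

definition pos_part :: "int ^ 's \<Rightarrow> nat ^ 's::finite"
  where "pos_part a = (\<chi> j. nat (a $ j))"

definition neg_part :: "int ^ 's \<Rightarrow> nat ^ 's::finite"
  where "neg_part a = (\<chi> j. nat (- (a $ j)))"

definition lattice_ideal :: "(int ^ 's::finite) set \<Rightarrow> ('k::field, 's) mpol set"
  where "lattice_ideal L =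
    genideal mpol_ring {monomial (pos_part a) - monomial (neg_part a) | a. a \<in> L}"


text \<open>The zero ring, which has no prime ideals, gets dimension \<open>0\<close> here (the supremum of \<open>{}\<close>).\<close>

definition krull_dim :: "('a, 'b) ring_scheme \<Rightarrow> enat"
  where "krull_dim R = Sup {enat n | n.
    \<exists>P. (\<forall>i\<le>n. primeideal (P i) R) \<and> (\<forall>i<n. P i \<subset> P (Suc i))}"


definition weighted_degree :: "nat ^ 's \<Rightarrow> nat ^ 's \<Rightarrow> nat"
  where "weighted_degree d c = (\<Sum>j\<in>UNIV. d $ j * c $ j)"

definition homogeneous_component ::
    "nat ^ 's \<Rightarrow> nat \<Rightarrow> ('k::field, 's::finite) mpol \<Rightarrow> ('k, 's) mpol"
  where "homogeneous_component d n f =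
    (\<Sum>c\<in>{c \<in> Poly_Mapping.keys f. weighted_degree d c = n}.
       Poly_Mapping.single c (Poly_Mapping.lookup f c))"

definition homogeneous_ideal :: "nat ^ 's \<Rightarrow> ('k::field, 's::finite) mpol set \<Rightarrow> bool"
  where "homogeneous_ideal d I \<longleftrightarrow> (\<forall>f\<in>I. \<forall>n. homogeneous_component d n f \<in> I)"


definition mpol_space :: "('k, ('k::field, 's::finite) mpol) module"
  where "mpol_space = ring.extend mpol_ring \<lparr>module.smult = (\<lambda>a. Poly_Mapping.map ((*) a))\<rparr>"

definition polys_upto :: "nat \<Rightarrow> ('k::field, 's::finite) mpol set"
  where "polys_upto i = {f. \<forall>c\<in>Poly_Mapping.keys f. (\<Sum>j\<in>UNIV. c $ j) \<le> i}"

text \<open>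
  \<open>V Quot W\<close> supplies the cosets \<open>W + v\<close> (\<open>v\<close> in the carrier of \<open>V\<close>) with their addition; its
  multiplication is meaningless for a mere subspace \<open>W\<close>, but is not used by the vector space locale.
  In the scalar action the union makes \<open>0 \<odot> A\<close> equal to \<open>W\<close> rather than \<open>{0}\<close>.
\<close>

definition quotient_space :: "('a, 'v) module \<Rightarrow> 'v set \<Rightarrow> ('a, 'v set) module"
  where "quotient_space V W =
    ring.extend (V Quot W) \<lparr>module.smult = (\<lambda>a A. \<Union>x\<in>A. W +>\<^bsub>V\<^esub> (a \<odot>\<^bsub>V\<^esub> x))\<rparr>"

definition affine_hilbert_function :: "('k::field, 's::finite) mpol set \<Rightarrow> nat \<Rightarrow> nat"
  where "affine_hilbert_function I i =
    vectorspace.dim (ring_of_type_algebra :: 'k ring)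
      (quotient_space (mpol_space\<lparr>carrier := polys_upto i\<rparr>) (I \<inter> polys_upto i))"

definition quotient_degree :: "('k::field, 's::finite) mpol set \<Rightarrow> real"
  where "quotient_degree I = (let k = the_enat (krull_dim (mpol_ring Quot I)) in
    fact k * lim (\<lambda>i. real (affine_hilbert_function I i) / real i ^ k))"

end

(*
  The binomials generating I(L) say that t^b and t^c agree modulo I(L) whenever b - c lies in L, so f is
  in I(L) exactly when, for every coset of L, the coefficients of f on that coset sum to zero. Hence the
  affine Hilbert function at i counts the cosets of L that contain a point of N^s with coordinate sum at
  most i.

  Homogeneity puts L inside the hyperplane d . a = 0. If some c in this hyperplane had no positive
  multiple in L, there would be a rational functional e vanishing on L but not at c; for an irrational
  theta the kernels of t^b |-> x^(d . b + theta e . b), t^b |-> x^(d . b) and t^b |-> 1 would then be a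
  chain of three primes above I(L), contradicting dimension 1. So the hyperplane modulo L is the torsion
  group T of Z^s / L.

  Put w = d / gcd(d). The level sets of w on Z^s / L all have |T| elements. The points counted by the
  Hilbert function have levels in [0, i max w], and conversely, up to bounded errors at both ends of this
  interval, every element of these levels is hit: move it by multiples of the basis vector of maximal
  weight, modulo which Z^s / L is finite. The count is therefore i |T| max w + O(1).
*)

theory Submission
  imports Defs "HOL-Real_Asymp.Real_Asymp" "HOL-Analysis.Cartesian_Space"
    "HOL-Analysis.Continuum_Not_Denumerable"
begin

section \<open>Cosets of a lattice in a grading\<close>

definition int_vec :: "nat ^ 's \<Rightarrow> int ^ 's"
  where "int_vec c = (\<chi> j. int (c $ j))"

definition int_weight :: "nat ^ 's \<Rightarrow> int ^ 's::finite \<Rightarrow> int"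
  where "int_weight d a = (\<Sum>j\<in>UNIV. int (d $ j) * a $ j)"

text \<open>Cosets are plain sets of vectors, so they can index the coefficients of a polynomial
  directly, and congruence modulo \<open>L\<close> becomes equality of sets.\<close>

definition coset :: "(int ^ 's) set \<Rightarrow> int ^ 's::finite \<Rightarrow> (int ^ 's) set"
  where "coset L a = {x. x - a \<in> L}"

lemma int_vec_nth [simp]: "int_vec c $ j = int (c $ j)"
  by (simp add: int_vec_def)

lemma int_vec_add: "int_vec (b + c) = int_vec b + int_vec c"
  by (simp add: vec_eq_iff)

lemma int_weight_add: "int_weight d (a + b) = int_weight d a + int_weight d b"
  by (simp add: int_weight_def distrib_left sum.distrib)

lemma int_weight_diff: "int_weight d (a - b) = int_weight d a - int_weight d b"
  by (simp add: int_weight_def right_diff_distrib sum_subtractf)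

lemma int_weight_smult: "int_weight d (k *s a) = k * int_weight d a"
  by (simp add: int_weight_def sum_distrib_left mult.left_commute)

lemma int_weight_axis: "int_weight d (axis j k) = int (d $ j) * k"
  by (simp add: int_weight_def axis_def if_distrib cong: if_cong)

lemma int_weight_int_vec: "int_weight d (int_vec c) = int (weighted_degree d c)"
  by (simp add: int_weight_def weighted_degree_def)

section \<open>Subgroups of Z^s and their cosets\<close>

locale int_lattice =
  fixes L :: "(int ^ 's::finite) set"
  assumes zero_mem: "0 \<in> L"
    and add_mem: "a \<in> L \<Longrightarrow> b \<in> L \<Longrightarrow> a + b \<in> L"
    and uminus_mem: "a \<in> L \<Longrightarrow> - a \<in> L"
begin

lemma diff_mem: "a \<in> L \<Longrightarrow> b \<in> L \<Longrightarrow> a - b \<in> L"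
  using add_mem[of a "- b"] uminus_mem by simp

lemma diff_commute_mem: "a - b \<in> L \<longleftrightarrow> b - a \<in> L"
  using uminus_mem[of "a - b"] uminus_mem[of "b - a"] by auto

lemma nat_smult_mem: "a \<in> L \<Longrightarrow> int n *s a \<in> L"
proof (induction n)
  case (Suc n)
  then have "int n *s a + a \<in> L"
    by (intro add_mem) auto
  moreover have "int n *s a + a = int (Suc n) *s a"
    by (simp add: vec_eq_iff distrib_right)
  ultimately show ?case
    by simp
qed (simp add: zero_mem)

lemma smult_mem:
  assumes "a \<in> L"
  shows "k *s a \<in> L"
proof (cases "k \<ge> 0")
  case True
  then show ?thesis
    using nat_smult_mem[OF assms, of "nat k"] by simp
next
  case False
  then have "k *s a = - (int (nat (- k)) *s a)"
    by (simp add: vec_eq_iff)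
  then show ?thesis
    by (metis assms nat_smult_mem uminus_mem)
qed

lemma sum_mem: "(\<And>x. x \<in> A \<Longrightarrow> f x \<in> L) \<Longrightarrow> sum f A \<in> L"
  by (induction A rule: infinite_finite_induct) (auto simp: zero_mem add_mem)

lemma mem_coset_self: "a \<in> coset L a"
  by (simp add: coset_def zero_mem)

lemma coset_eq_iff: "coset L a = coset L b \<longleftrightarrow> a - b \<in> L"
proof
  assume "coset L a = coset L b"
  then have "a \<in> coset L b"
    using mem_coset_self by blast
  then show "a - b \<in> L"
    by (simp add: coset_def)
next
  assume ab: "a - b \<in> L"
  have "x - a \<in> L \<longleftrightarrow> x - b \<in> L" for x
    using add_mem[OF _ ab, of "x - a"] diff_mem[OF _ ab, of "x - b"] by auto
  then show "coset L a = coset L b"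
    by (simp add: coset_def)
qed

text \<open>Translation acts on cosets by taking images. Adding a fixed vector to all exponents
  thereby becomes a map applied after the formation of cosets.\<close>

lemma coset_add: "coset L (b + a) = (+) b ` coset L a"
proof -
  have "x \<in> (+) b ` coset L a" if "x - (b + a) \<in> L" for x
    using that by (intro image_eqI[of _ _ "x - b"]) (auto simp: coset_def algebra_simps)
  then show ?thesis
    by (auto simp: coset_def algebra_simps)
qed

end

text \<open>The combinatorial setting of the count. The vector \<open>w\<close> stands for the
  degrees divided by their gcd, whence \<open>weight_surj\<close>; \<open>weight_mem\<close> and
  \<open>saturation\<close> together identify the vectors of weight 0 with those that are torsion
  modulo \<open>L\<close>.\<close>

locale graded_lattice = int_lattice +
  fixes w :: "nat ^ 's"
  assumes w_pos: "0 < w $ j"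
    and weight_mem: "a \<in> L \<Longrightarrow> int_weight w a = 0"
    and weight_surj: "\<exists>u. int_weight w u = 1"
    and saturation: "int_weight w a = 0 \<Longrightarrow> \<exists>n>0. n *s a \<in> L"
begin

text \<open>A level set of the weight on Z^s / L. Level 0 will be the torsion subgroup.\<close>

definition fiber :: "int \<Rightarrow> (int ^ 's) set set"
  where "fiber n = coset L ` {a. int_weight w a = n}"

text \<open>Its cardinality will turn out to be the affine Hilbert function of the lattice ideal at
  \<open>i\<close>.\<close>

definition hit :: "nat \<Rightarrow> (int ^ 's) set set"
  where "hit i = (\<lambda>c. coset L (int_vec c)) ` {c. (\<Sum>j\<in>UNIV. c $ j) \<le> i}"

lemma weight_coset: "coset L a = coset L b \<Longrightarrow> int_weight w a = int_weight w b"
  using coset_eq_iff weight_mem int_weight_diff by (metis eq_iff_diff_eq_0)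

text \<open>Translation by \<open>n\<close> times a vector of weight 1 maps level 0 bijectively onto
  level \<open>n\<close>.\<close>

lemma card_fiber: "card (fiber n) = card (fiber 0)"
proof -
  obtain u where u: "int_weight w u = 1"
    using weight_surj by blast
  have "fiber n = (`) ((+) (n *s u)) ` fiber 0"
  proof (intro equalityI subsetI)
    fix Y assume "Y \<in> fiber n"
    then obtain a where a: "Y = coset L a" "int_weight w a = n"
      by (auto simp: fiber_def)
    then have "coset L (a - n *s u) \<in> fiber 0"
      using u by (auto simp: fiber_def int_weight_diff int_weight_smult)
    moreover have "Y = (+) (n *s u) ` coset L (a - n *s u)"
      using a by (simp flip: coset_add)
    ultimately show "Y \<in> (`) ((+) (n *s u)) ` fiber 0"
      by blast
  qed (use u in \<open>auto simp: fiber_def int_weight_add int_weight_smult simp flip: coset_add\<close>)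
  moreover have "inj ((`) ((+) (n *s u)))"
    by (rule injI) (simp add: inj_image_eq_iff)
  ultimately show ?thesis
    by (simp add: card_image inj_on_subset)
qed

text \<open>For suitable \<open>N\<close> these vectors represent Z^s modulo \<open>L\<close> and
  the axis of \<open>j0\<close>. Coordinate \<open>j0\<close> is fixed at 0 because shifts along
  that axis are recorded separately; nonnegative entries let box elements act as exponent
  vectors.\<close>

definition box :: "'s \<Rightarrow> int \<Rightarrow> (int ^ 's) set"
  where "box j0 N = {f. f $ j0 = 0 \<and> (\<forall>j. f $ j \<in> {0..<N})}"

lemma finite_box: "finite (box j0 N)"
proof (rule finite_subset)
  show "box j0 N \<subseteq> vec_lambda ` (\<Pi>\<^sub>E j\<in>UNIV. {0..<N})"
  proof
    fix f assume "f \<in> box j0 N"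
    then show "f \<in> vec_lambda ` (\<Pi>\<^sub>E j\<in>UNIV. {0..<N})"
      by (intro image_eqI[of _ _ "vec_nth f"]) (auto simp: box_def)
  qed
  show "finite (vec_lambda ` (\<Pi>\<^sub>E j\<in>(UNIV :: 's set). {0..<N}))"
    by (intro finite_imageI finite_PiE) auto
qed

text \<open>The vector \<open>r j\<close>, which trades \<open>w $ j0\<close> units of coordinate
  \<open>j\<close> for \<open>w $ j\<close> units of coordinate \<open>j0\<close>, has weight 0, so
  saturation puts a positive multiple of it into \<open>L\<close>. With a common multiplier
  \<open>M\<close>, every coordinate other than \<open>j0\<close> can be reduced modulo
  \<open>N = M * D\<close>.\<close>

lemma box_representatives:
  "\<exists>N. \<forall>a. \<exists>f\<in>box j0 N. \<exists>k. a - (f + axis j0 k) \<in> L"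
proof -
  define D where "D = int (w $ j0)"
  have D: "D > 0"
    by (simp add: D_def w_pos)
  define r where "r j = D *s axis j 1 - int (w $ j) *s axis j0 1" for j
  have "int_weight w (r j) = 0" for j
    by (simp add: r_def int_weight_diff int_weight_smult int_weight_axis D_def)
  then have "\<exists>n>0. n *s r j \<in> L" for j
    using saturation by blast
  then obtain m where m: "\<And>j. m j > 0" "\<And>j. m j *s r j \<in> L"
    by metis
  define M where "M = (\<Prod>j\<in>UNIV. m j)"
  have M: "M > 0"
    using m by (simp add: M_def prod_pos)
  have Mr: "M *s r j \<in> L" for j
  proof -
    have "M = (\<Prod>i\<in>UNIV-{j}. m i) * m j"
      by (simp add: M_def prod.remove[of _ j] mult.commute)
    then show ?thesis
      using smult_mem[OF m(2)[of j], of "\<Prod>i\<in>UNIV-{j}. m i"]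
      by (simp add: vector_smult_assoc)
  qed
  define N where "N = M * D"
  have N: "N > 0"
    using M D by (simp add: N_def)
  have "\<exists>f\<in>box j0 N. \<exists>k. a - (f + axis j0 k) \<in> L" for a
  proof -
    define f where "f = (\<chi> j. if j = j0 then 0 else a $ j mod N)"
    define q where "q j = a $ j div N" for j
    \<comment> \<open>Modulo \<open>L\<close>, each block of \<open>N\<close> units removed from
      coordinate \<open>j\<close> reappears as \<open>M * w $ j\<close> units in coordinate
      \<open>j0\<close>.\<close>
    define k where "k = a $ j0 + (\<Sum>j\<in>UNIV-{j0}. q j * (M * int (w $ j)))"
    have "f \<in> box j0 N"
      using N by (simp add: box_def f_def)
    moreover have "a - (f + axis j0 k) = (\<Sum>j\<in>UNIV-{j0}. q j *s (M *s r j))"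
    proof -
      have "(\<Sum>j\<in>UNIV-{j0}. q j * (M * r j $ i)) = (a - (f + axis j0 k)) $ i" for i
      proof (cases "i = j0")
        case True
        have "(\<Sum>j\<in>UNIV-{j0}. q j * (M * r j $ j0)) = (\<Sum>j\<in>UNIV-{j0}. - (q j * (M * int (w $ j))))"
          by (intro sum.cong) (auto simp: r_def axis_def)
        then show ?thesis
          using True by (simp add: k_def f_def axis_def sum_negf)
      next
        case False
        have "(\<Sum>j\<in>UNIV-{j0}. q j * (M * r j $ i)) = (\<Sum>j\<in>UNIV-{j0}. if j = i then q i * N else 0)"
          using False by (intro sum.cong) (auto simp: r_def axis_def N_def)
        also have "\<dots> = q i * N"
          using False by simp
        finally show ?thesis
          using False by (simp add: f_def axis_def q_def minus_mod_eq_div_mult)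
      qed
      then show ?thesis
        by (simp add: vec_eq_iff)
    qed
    then have "a - (f + axis j0 k) \<in> L"
      using Mr by (simp add: sum_mem smult_mem)
    ultimately show ?thesis
      by blast
  qed
  then show ?thesis
    by blast
qed

text \<open>Once the box vector \<open>f\<close> is chosen, the weight \<open>n\<close> forces the
  shift \<open>k\<close>, so each of the finitely many box vectors accounts for at most one coset of
  level \<open>n\<close>.\<close>

lemma finite_fiber: "finite (fiber n)"
proof -
  fix j0 :: 's
  obtain N where N: "\<And>a. \<exists>f\<in>box j0 N. \<exists>k. a - (f + axis j0 k) \<in> L"
    using box_representatives by blast
  define h where "h f = coset L (f + axis j0 ((n - int_weight w f) div int (w $ j0)))" for f
  have "fiber n \<subseteq> h ` box j0 N"
  proof
    fix Y assume "Y \<in> fiber n"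
    then obtain a where a: "Y = coset L a" "int_weight w a = n"
      by (auto simp: fiber_def)
    obtain f k where f: "f \<in> box j0 N" "a - (f + axis j0 k) \<in> L"
      using N by blast
    then have Y_eq: "Y = coset L (f + axis j0 k)"
      by (simp add: a coset_eq_iff)
    then have "n = int_weight w f + int (w $ j0) * k"
      using weight_coset a by (metis int_weight_add int_weight_axis)
    then have "(n - int_weight w f) div int (w $ j0) = k"
      using w_pos[of j0] by simp
    then show "Y \<in> h ` box j0 N"
      using Y_eq f by (auto simp: h_def)
  qed
  then show ?thesis
    by (rule finite_subset) (simp add: finite_box)
qed

text \<open>The weight is constant on a coset, so distinct levels are disjoint, and all levels have
  equal size. For an empty interval \<open>nat\<close> makes the right-hand side 0.\<close>

lemma card_fibers: "card (\<Union>n\<in>{a..b}. fiber n) = card (fiber 0) * nat (b - a + 1)"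
proof -
  have "disjoint_family_on fiber {a..b}"
    unfolding disjoint_family_on_def
  proof (intro ballI impI)
    fix m n :: int assume "m \<noteq> n"
    have "False" if "Y \<in> fiber m" "Y \<in> fiber n" for Y
      using that weight_coset \<open>m \<noteq> n\<close> unfolding fiber_def by (metis (mono_tags, lifting) imageE mem_Collect_eq)
    then show "fiber m \<inter> fiber n = {}"
      by blast
  qed
  then have "card (\<Union>n\<in>{a..b}. fiber n) = (\<Sum>n\<in>{a..b}. card (fiber n))"
    by (simp add: card_UN_disjoint' finite_fiber)
  also have "\<dots> = (\<Sum>n\<in>{a..b}. card (fiber 0))"
    by (intro sum.cong refl card_fiber)
  finally show ?thesis
    by (simp add: mult.commute)
qed

section \<open>Counting the cosets hit in bounded total degree\<close>

definition max_weight :: nat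
  where "max_weight = (MAX j. w $ j)"

lemma weight_le_max: "w $ j \<le> max_weight"
  by (simp add: max_weight_def)

text \<open>Each unit of total degree contributes at most \<open>max_weight\<close> to the
  weight.\<close>

lemma hit_subset: "hit i \<subseteq> (\<Union>n\<in>{0..int (max_weight * i)}. fiber n)"
proof
  fix Y assume "Y \<in> hit i"
  then obtain c where c: "Y = coset L (int_vec c)" "(\<Sum>j\<in>UNIV. c $ j) \<le> i"
    by (auto simp: hit_def)
  have "weighted_degree w c \<le> (\<Sum>j\<in>UNIV. max_weight * c $ j)"
    unfolding weighted_degree_def by (intro sum_mono mult_right_mono weight_le_max) simp
  also have "\<dots> \<le> max_weight * i"
    using c by (simp flip: sum_distrib_left)
  finally have "int_weight w (int_vec c) \<in> {0..int (max_weight * i)}"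
    by (simp add: int_weight_int_vec del: of_nat_mult)
  then show "Y \<in> (\<Union>n\<in>{0..int (max_weight * i)}. fiber n)"
    using c by (auto simp: fiber_def)
qed

text \<open>Represent a coset by \<open>f + axis j0 k\<close> with \<open>f\<close> in the box and
  \<open>j0\<close> of maximal weight, so that the slope agrees with the upper bound. Here
  \<open>C\<close> and \<open>A\<close> bound the weight and the coordinate sum on the box: a level
  of at least \<open>C\<close> forces \<open>k \<ge> 0\<close>, and the upper end of the interval
  forces \<open>k \<le> i - A\<close>, hence total degree at most \<open>i\<close>.\<close>

lemma subset_hit: "\<exists>C A. \<forall>i. (\<Union>n\<in>{C..int max_weight * (int i - A)}. fiber n) \<subseteq> hit i"
proof -
  have "max_weight \<in> range (($) w)"
    unfolding max_weight_def by (intro Max_in) auto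
  then obtain j0 where j0: "w $ j0 = max_weight"
    by auto
  define D where "D = int max_weight"
  have D: "D > 0"
    using w_pos[of j0] by (simp add: D_def j0)
  obtain N where N: "\<And>a. \<exists>f\<in>box j0 N. \<exists>k. a - (f + axis j0 k) \<in> L"
    using box_representatives by blast
  define C where "C = Max (int_weight w ` box j0 N)"
  define A where "A = Max ((\<lambda>f. \<Sum>j\<in>UNIV. f $ j) ` box j0 N)"
  have "Y \<in> hit i" if n_range: "n \<in> {C..D * (int i - A)}" and Y: "Y \<in> fiber n" for n i Y
  proof -
    obtain a where a: "Y = coset L a" "int_weight w a = n"
      using Y by (auto simp: fiber_def)
    obtain f k where f: "f \<in> box j0 N" "a - (f + axis j0 k) \<in> L"
      using N by blast
    then have Y_eq: "Y = coset L (f + axis j0 k)"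
      by (simp add: a coset_eq_iff)
    then have n: "n = int_weight w f + D * k"
      using weight_coset a by (metis int_weight_add int_weight_axis j0 D_def)
    have "int_weight w f \<le> C"
      using f by (simp add: C_def finite_box)
    then have "D * k \<ge> 0"
      using n n_range by simp
    then have k: "k \<ge> 0"
      using D by (simp add: zero_le_mult_iff)
    have fpos: "f $ j \<ge> 0" for j
      using f by (simp add: box_def)
    then have "int_weight w f \<ge> 0"
      by (simp add: int_weight_def sum_nonneg)
    then have "D * k \<le> D * (int i - A)"
      using n n_range by simp
    then have "k \<le> int i - A"
      using D by simp
    moreover have "(\<Sum>j\<in>UNIV. f $ j) \<le> A"
      using f by (simp add: A_def finite_box)
    ultimately have le: "(\<Sum>j\<in>UNIV. (f + axis j0 k) $ j) \<le> int i"
      by (simp add: sum.distrib axis_def)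
    define c where "c = (\<chi> j. nat ((f + axis j0 k) $ j))"
    have c: "int_vec c = f + axis j0 k"
      using fpos k by (simp add: c_def vec_eq_iff axis_def)
    then have "int (\<Sum>j\<in>UNIV. c $ j) \<le> int i"
      using le by (simp flip: c)
    then have "(\<Sum>j\<in>UNIV. c $ j) \<le> i"
      by (simp only: of_nat_le_iff)
    then show ?thesis
      unfolding hit_def by (intro image_eqI[of _ _ c]) (simp_all add: Y_eq c)
  qed
  then show ?thesis
    unfolding D_def by (intro exI allI subsetI) blast
qed

lemma finite_hit: "finite (hit i)"
  by (rule finite_subset[OF hit_subset]) (auto simp: finite_fiber)

lemma hit_asymptotics:
  "(\<lambda>i. real (card (hit i)) / real i) \<longlonglongrightarrow> real max_weight * real (card (fiber 0))"
proof -
  define m where "m = real (card (fiber 0))"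
  define D where "D = real max_weight"
  obtain C A where AC: "\<And>i. (\<Union>n\<in>{C..int max_weight * (int i - A)}. fiber n) \<subseteq> hit i"
    using subset_hit by auto
  \<comment> \<open>Small \<open>i\<close> are covered as well: when the interval of levels is
    empty, the left-hand side is at most 0.\<close>
  have lower: "m * (D * (real i - A) - C + 1) \<le> real (card (hit i))" for i
  proof -
    have "m * (D * (real i - A) - C + 1) \<le> m * real (nat (int max_weight * (int i - A) - C + 1))"
    proof (rule mult_left_mono)
      have "D * (real i - A) - C + 1 = real_of_int (int max_weight * (int i - A) - C + 1)"
        by (simp add: D_def)
      also have "\<dots> \<le> real (nat (int max_weight * (int i - A) - C + 1))"
        by linarith
      finally show "D * (real i - A) - C + 1 \<le> real (nat (int max_weight * (int i - A) - C + 1))" .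
    qed (simp add: m_def)
    also have "\<dots> = real (card (\<Union>n\<in>{C..int max_weight * (int i - A)}. fiber n))"
      by (simp add: card_fibers m_def)
    also have "\<dots> \<le> real (card (hit i))"
      using card_mono[OF finite_hit AC] by simp
    finally show ?thesis .
  qed
  have upper: "real (card (hit i)) \<le> m * (D * real i + 1)" for i
  proof -
    have "card (hit i) \<le> card (\<Union>n\<in>{0..int (max_weight * i)}. fiber n)"
      by (intro card_mono hit_subset) (simp add: finite_fiber)
    also have "\<dots> = card (fiber 0) * (max_weight * i + 1)"
      by (simp add: card_fibers nat_add_distrib nat_mult_distrib)
    finally have "real (card (hit i)) \<le> real (card (fiber 0) * (max_weight * i + 1))"
      by (simp only: of_nat_le_iff)
    then show ?thesis
      by (simp add: m_def D_def distrib_left)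
  qed
  have "(\<lambda>i. real (card (hit i)) / real i) \<longlonglongrightarrow> D * m"
  proof (rule tendsto_sandwich)
    show "(\<lambda>i. m * (D * (real i - A) - C + 1) / real i) \<longlonglongrightarrow> D * m"
      by real_asymp
    show "(\<lambda>i. m * (D * real i + 1) / real i) \<longlonglongrightarrow> D * m"
      by real_asymp
  qed (use lower upper in \<open>auto intro!: always_eventually divide_right_mono\<close>)
  then show ?thesis
    by (simp add: D_def m_def)
qed

end

section \<open>Push-forward of polynomials\<close>

definition push :: "('a \<Rightarrow> 'b) \<Rightarrow> ('a \<Rightarrow>\<^sub>0 'k::comm_monoid_add) \<Rightarrow> ('b \<Rightarrow>\<^sub>0 'k)"
  where "push \<phi> f = (\<Sum>c\<in>Poly_Mapping.keys f. Poly_Mapping.single (\<phi> c) (Poly_Mapping.lookup f c))"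

lemma push_superset:
  "finite A \<Longrightarrow> Poly_Mapping.keys f \<subseteq> A \<Longrightarrow>
    push \<phi> f = (\<Sum>c\<in>A. Poly_Mapping.single (\<phi> c) (Poly_Mapping.lookup f c))"
  unfolding push_def by (intro sum.mono_neutral_left) (auto simp: in_keys_iff)

lemma push_zero [simp]: "push \<phi> 0 = 0"
  by (simp add: push_def)

lemma push_single [simp]: "push \<phi> (Poly_Mapping.single c a) = Poly_Mapping.single (\<phi> c) a"
  by (simp add: push_superset[of "{c}"])

lemma push_add: "push \<phi> (f + g) = push \<phi> f + push \<phi> g"
proof -
  let ?A = "Poly_Mapping.keys f \<union> Poly_Mapping.keys g"
  have "Poly_Mapping.keys (f + g) \<subseteq> ?A"
    by (rule Poly_Mapping.keys_add)
  then show ?thesis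
    by (simp add: push_superset[of ?A] lookup_add single_add sum.distrib)
qed

lemma push_sum: "push \<phi> (sum h A) = (\<Sum>x\<in>A. push \<phi> (h x))"
  by (induction A rule: infinite_finite_induct) (simp_all add: push_add)

lemma push_uminus: "push \<phi> (- f) = - push \<phi> (f :: 'a \<Rightarrow>\<^sub>0 'k::ab_group_add)"
  by (rule minus_unique[symmetric]) (simp flip: push_add)

lemma push_diff: "push \<phi> (f - g) = push \<phi> f - push \<phi> (g :: 'a \<Rightarrow>\<^sub>0 'k::ab_group_add)"
  using push_add[of \<phi> f "- g"] by (simp add: push_uminus)

lemma push_push: "push \<psi> (push \<phi> f) = push (\<psi> \<circ> \<phi>) f"
  by (simp add: push_def[of \<phi>] push_def[of "\<psi> \<circ> \<phi>"] push_sum)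

lemma push_id: "push id f = f"
proof (rule poly_mapping_eqI)
  show "Poly_Mapping.lookup (push id f) c = Poly_Mapping.lookup f c" for c
    by (cases "c \<in> Poly_Mapping.keys f")
      (auto simp: push_def lookup_sum lookup_single when_def in_keys_iff sum.delta')
qed

lemma poly_mapping_sum_single:
  "(\<Sum>c\<in>Poly_Mapping.keys f. Poly_Mapping.single c (Poly_Mapping.lookup f c)) = f"
  using push_id[of f] by (simp add: push_def)

lemma lookup_push:
  "Poly_Mapping.lookup (push \<phi> f) y = (\<Sum>c\<in>{c \<in> Poly_Mapping.keys f. \<phi> c = y}. Poly_Mapping.lookup f c)"
  by (simp add: push_def lookup_sum lookup_single when_def flip: sum.inter_filter)

lemma keys_push: "Poly_Mapping.keys (push \<phi> f) \<subseteq> \<phi> ` Poly_Mapping.keys f"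
proof
  fix y assume "y \<in> Poly_Mapping.keys (push \<phi> f)"
  then have "{c \<in> Poly_Mapping.keys f. \<phi> c = y} \<noteq> {}"
    by (auto simp: in_keys_iff lookup_push simp del: Collect_empty_eq intro: ccontr)
  then show "y \<in> \<phi> ` Poly_Mapping.keys f"
    by blast
qed

lemma push_mult:
  fixes f g :: "'a::monoid_add \<Rightarrow>\<^sub>0 'k::semiring_0"
    and \<phi> :: "'a \<Rightarrow> 'b::monoid_add"
  assumes "\<And>x y. \<phi> (x + y) = \<phi> x + \<phi> y"
  shows "push \<phi> (f * g) = push \<phi> f * push \<phi> g"
proof -
  have "push \<phi> (f * g) = push \<phi>
     ((\<Sum>c\<in>Poly_Mapping.keys f. Poly_Mapping.single c (Poly_Mapping.lookup f c)) *
      (\<Sum>c\<in>Poly_Mapping.keys g. Poly_Mapping.single c (Poly_Mapping.lookup g c)))"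
    by (simp only: poly_mapping_sum_single)
  also have "\<dots> = push \<phi> f * push \<phi> g"
    by (simp add: sum_product push_sum mult_single assms push_def[of _ f] push_def[of _ g])
  finally show ?thesis .
qed

lemma map_scale_zero: "Poly_Mapping.map ((*) a) 0 = (0 :: 'a \<Rightarrow>\<^sub>0 'k::mult_zero)"
  by (rule poly_mapping_eqI) (simp add: Poly_Mapping.map.rep_eq)

text \<open>This takes the place of \<open>push_mult\<close> when the target of
  \<open>\<phi>\<close> carries no addition, as for cosets: multiplication by a term shifts the
  argument of \<open>\<phi>\<close> and scales the coefficients.\<close>

lemma push_single_mult:
  fixes f :: "'a::monoid_add \<Rightarrow>\<^sub>0 'k::comm_semiring_0"
  shows "push \<phi> (Poly_Mapping.single c a * f) = Poly_Mapping.map ((*) a) (push (\<lambda>x. \<phi> (c + x)) f)"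
proof -
  have map_sum: "Poly_Mapping.map ((*) a) (sum h A) = (\<Sum>x\<in>A. Poly_Mapping.map ((*) a) (h x))"
    for h :: "'x \<Rightarrow> 'c \<Rightarrow>\<^sub>0 'k" and A
  proof (induction A rule: infinite_finite_induct)
    case (insert x A)
    have "Poly_Mapping.map ((*) a) (u + v) = Poly_Mapping.map ((*) a) u + Poly_Mapping.map ((*) a) v"
      for u v :: "'c \<Rightarrow>\<^sub>0 'k"
      by (rule poly_mapping_eqI) (simp add: lookup_add Poly_Mapping.map.rep_eq when_def flip: distrib_left)
    then show ?case
      using insert by simp
  qed (simp_all add: map_scale_zero)
  have "Poly_Mapping.single c a * f = Poly_Mapping.single c a *
      (\<Sum>x\<in>Poly_Mapping.keys f. Poly_Mapping.single x (Poly_Mapping.lookup f x))"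
    by (simp only: poly_mapping_sum_single)
  then show ?thesis
    by (simp add: sum_distrib_left push_sum mult_single push_def[of _ f] map_sum)
qed

section \<open>Lattice ideals and the primes above them\<close>

lemma ring_of_type_algebra_simps [simp]:
  "carrier ring_of_type_algebra = UNIV"
  "x \<otimes>\<^bsub>ring_of_type_algebra\<^esub> y = x * y"
  "x \<oplus>\<^bsub>ring_of_type_algebra\<^esub> y = x + y"
  "\<zero>\<^bsub>ring_of_type_algebra\<^esub> = 0"
  "\<one>\<^bsub>ring_of_type_algebra\<^esub> = 1"
  by (simp_all add: ring_of_type_algebra_def)

lemma ideal_ring_of_type_algebraI:
  assumes "0 \<in> I" "\<And>x y. x \<in> I \<Longrightarrow> y \<in> I \<Longrightarrow> x + y \<in> I" "\<And>r x. x \<in> I \<Longrightarrow> r * x \<in> I"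
  shows "ideal I (ring_of_type_algebra :: 'a::comm_ring_1 ring)"
proof -
  have inv: "inv\<^bsub>add_monoid (ring_of_type_algebra :: 'a ring)\<^esub> x = - x" for x :: 'a
  proof -
    interpret ring "ring_of_type_algebra :: 'a ring"
      by (rule ring_from_type_algebra)
    show ?thesis
      using minus_equality[of "- x" x] by (simp add: a_inv_def)
  qed
  have neg: "- x \<in> I" if "x \<in> I" for x
    using assms(3)[OF that, of "- 1"] by simp
  show ?thesis
  proof (rule idealI)
    show "subgroup I (add_monoid (ring_of_type_algebra :: 'a ring))"
    proof (rule subgroup.intro)
      show "inv\<^bsub>add_monoid (ring_of_type_algebra :: 'a ring)\<^esub> x \<in> I" if "x \<in> I" for x
        unfolding inv using that by (rule neg)
    qed (use assms in simp_all)
  qed (use assms in \<open>auto intro: ring_from_type_algebra simp: mult.commute\<close>)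
qed

lemma ideal_ring_of_type_algebraD:
  assumes "ideal I (ring_of_type_algebra :: 'a::comm_ring_1 ring)"
  shows "0 \<in> I" "\<And>x y. x \<in> I \<Longrightarrow> y \<in> I \<Longrightarrow> x + y \<in> I" "\<And>r x. x \<in> I \<Longrightarrow> r * x \<in> I"
proof -
  interpret ideal I "ring_of_type_algebra :: 'a ring" by fact
  show "0 \<in> I" "\<And>x y. x \<in> I \<Longrightarrow> y \<in> I \<Longrightarrow> x + y \<in> I" "\<And>r x. x \<in> I \<Longrightarrow> r * x \<in> I"
    using additive_subgroup.zero_closed[OF is_additive_subgroup]
      additive_subgroup.a_closed[OF is_additive_subgroup] I_l_closed by simp_all
qed

lemma ideal_sum_closed:
  assumes "ideal I (ring_of_type_algebra :: 'a::comm_ring_1 ring)" "\<And>x. x \<in> A \<Longrightarrow> h x \<in> I"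
  shows "sum h A \<in> I"
  using assms(2) by (induction A rule: infinite_finite_induct)
    (auto intro: ideal_ring_of_type_algebraD[OF assms(1)])

section \<open>Membership in a lattice ideal\<close>

lemma int_vec_pos_neg_part: "int_vec (pos_part a) - int_vec (neg_part a) = a"
  by (simp add: vec_eq_iff pos_part_def neg_part_def)

lemma lattice_ideal_is_ideal: "ideal (lattice_ideal L :: ('k::field, 's::finite) mpol set) mpol_ring"
proof -
  interpret ring "mpol_ring :: ('k, 's) mpol ring"
    by (rule ring_from_type_algebra)
  show ?thesis
    unfolding lattice_ideal_def by (intro genideal_ideal) simp
qed

lemma binomial_in_lattice_ideal:
  "a \<in> L \<Longrightarrow> monomial (pos_part a) - monomial (neg_part a) \<in> (lattice_ideal L :: ('k::field, 's::finite) mpol set)"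
proof -
  interpret ring "mpol_ring :: ('k, 's) mpol ring"
    by (rule ring_from_type_algebra)
  assume "a \<in> L"
  then show ?thesis
    unfolding lattice_ideal_def
    by (intro subsetD[OF genideal_self]) auto
qed

text \<open>The vector \<open>m\<close> is the componentwise minimum of \<open>b\<close> and
  \<open>c\<close>; splitting it off leaves the positive and negative parts of \<open>a\<close>, so
  the difference is a term times a generator.\<close>

lemma single_diff_in_lattice_ideal:
  assumes "int_vec c - int_vec b \<in> L"
  shows "Poly_Mapping.single c x - Poly_Mapping.single b x \<in> (lattice_ideal L :: ('k::field, 's::finite) mpol set)"
proof -
  define a where "a = int_vec c - int_vec b"
  define m where "m = c - pos_part a"
  have nth: "nat (int (c $ j) - int (b $ j)) = c $ j - b $ j" "nat (int (b $ j) - int (c $ j)) = b $ j - c $ j" for j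
    by simp_all
  have "m + pos_part a = c"
    by (simp add: m_def vec_eq_iff pos_part_def a_def nth)
  moreover have "(m + neg_part a) $ j = b $ j" for j
    by (cases "c $ j \<le> b $ j") (simp_all add: m_def pos_part_def neg_part_def a_def nth)
  then have "m + neg_part a = b"
    by (simp add: vec_eq_iff)
  ultimately have "Poly_Mapping.single c x - Poly_Mapping.single b x =
      Poly_Mapping.single m x * (monomial (pos_part a) - monomial (neg_part a))"
    by (simp add: monomial_def right_diff_distrib mult_single)
  moreover have "monomial (pos_part a) - monomial (neg_part a) \<in> (lattice_ideal L :: ('k, 's) mpol set)"
    using assms by (simp add: binomial_in_lattice_ideal a_def)
  ultimately show ?thesis
    by (simp add: ideal_ring_of_type_algebraD(3)[OF lattice_ideal_is_ideal])
qed

text \<open>In one direction, the polynomials whose coefficients sum to 0 on every coset form an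
  ideal containing the generators. In the other, moving each exponent to a chosen representative of
  its coset changes \<open>f\<close> only by elements of the lattice ideal and ends at 0.\<close>

lemma (in int_lattice) mem_lattice_ideal_iff:
  fixes f :: "('k::field, 's) mpol"
  shows "f \<in> lattice_ideal L \<longleftrightarrow> push (\<lambda>c. coset L (int_vec c)) f = 0"
proof
  let ?\<phi> = "\<lambda>c. coset L (int_vec c)"
  let ?J = "{f :: ('k, 's) mpol. push ?\<phi> f = 0}"
  have "r * f \<in> ?J" if "f \<in> ?J" for r f :: "('k, 's) mpol"
  proof -
    have "push ?\<phi> (Poly_Mapping.single c a * f) = 0" for c a
    proof -
      \<comment> \<open>The shift by \<open>c\<close> factors through the coset map, so it is
        applied to a push-forward that already vanishes.\<close>
      have "(\<lambda>x. ?\<phi> (c + x)) = (`) ((+) (int_vec c)) \<circ> ?\<phi>"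
        by (simp add: fun_eq_iff int_vec_add coset_add)
      then have "push (\<lambda>x. ?\<phi> (c + x)) f = 0"
        using that by (simp flip: push_push)
      then show ?thesis
        by (simp add: push_single_mult map_scale_zero)
    qed
    then have "push ?\<phi> ((\<Sum>c\<in>Poly_Mapping.keys r. Poly_Mapping.single c (Poly_Mapping.lookup r c)) * f) = 0"
      by (simp add: sum_distrib_right push_sum)
    then show ?thesis
      by (simp add: poly_mapping_sum_single)
  qed
  then have J: "ideal ?J mpol_ring"
    by (intro ideal_ring_of_type_algebraI) (auto simp: push_add)
  have gen: "monomial (pos_part a) - monomial (neg_part a) \<in> ?J" if "a \<in> L" for a
  proof -
    have "coset L (int_vec (pos_part a)) = coset L (int_vec (neg_part a))"
      using that by (simp add: coset_eq_iff int_vec_pos_neg_part)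
    then show ?thesis
      by (simp add: monomial_def push_diff)
  qed
  interpret ring "mpol_ring :: ('k, 's) mpol ring"
    by (rule ring_from_type_algebra)
  have "lattice_ideal L \<subseteq> ?J"
    unfolding lattice_ideal_def by (rule genideal_minimal[OF J]) (use gen in auto)
  then show "f \<in> lattice_ideal L \<Longrightarrow> push ?\<phi> f = 0"
    by blast
next
  let ?\<phi> = "\<lambda>c. coset L (int_vec c)"
  let ?I = "lattice_ideal L :: ('k, 's) mpol set"
  assume f: "push ?\<phi> f = 0"
  define \<rho> where "\<rho> = inv_into UNIV ?\<phi>"
  have \<rho>: "?\<phi> (\<rho> (?\<phi> c)) = ?\<phi> c" for c
    unfolding \<rho>_def by (rule f_inv_into_f) simp
  have "push (\<rho> \<circ> ?\<phi>) f = 0"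
    using f by (simp flip: push_push)
  \<comment> \<open>The subtracted terms add up to \<open>push (\<rho> \<circ> ?\<phi>) f\<close>,
    which is 0.\<close>
  then have eq: "f = (\<Sum>c\<in>Poly_Mapping.keys f. Poly_Mapping.single c (Poly_Mapping.lookup f c)
      - Poly_Mapping.single (\<rho> (?\<phi> c)) (Poly_Mapping.lookup f c))"
    by (simp add: sum_subtractf poly_mapping_sum_single push_def)
  have "int_vec c - int_vec (\<rho> (?\<phi> c)) \<in> L" for c
    using \<rho>[of c] by (simp only: coset_eq_iff diff_commute_mem)
  then have "(\<Sum>c\<in>Poly_Mapping.keys f. Poly_Mapping.single c (Poly_Mapping.lookup f c)
      - Poly_Mapping.single (\<rho> (?\<phi> c)) (Poly_Mapping.lookup f c)) \<in> ?I"
    by (intro ideal_sum_closed[OF lattice_ideal_is_ideal] single_diff_in_lattice_ideal)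
  then show "f \<in> ?I"
    by (rule back_subst) (rule eq[symmetric])
qed

section \<open>Prime ideals as kernels of maps to real exponents\<close>

text \<open>
  The exponents are real because the polynomials over a linearly ordered cancellative monoid form a
  domain, which makes this kernel prime when \<open>\<phi>\<close> is additive.
\<close>

definition kernel_ideal :: "(nat ^ 's::finite \<Rightarrow> real) \<Rightarrow> ('k::field, 's) mpol set"
  where "kernel_ideal \<phi> = {f. push \<phi> f = 0}"

lemma binomial_in_kernel_ideal_iff:
  "monomial b - monomial c \<in> (kernel_ideal \<phi> :: ('k::field, 's::finite) mpol set) \<longleftrightarrow> \<phi> b = \<phi> c"
proof
  assume "monomial b - monomial c \<in> (kernel_ideal \<phi> :: ('k, 's) mpol set)"
  then have "Poly_Mapping.single (\<phi> b) (1 :: 'k) = Poly_Mapping.single (\<phi> c) 1"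
    by (simp add: kernel_ideal_def monomial_def push_diff)
  then have "Poly_Mapping.keys (Poly_Mapping.single (\<phi> b) (1 :: 'k)) = Poly_Mapping.keys (Poly_Mapping.single (\<phi> c) (1 :: 'k))"
    by simp
  then show "\<phi> b = \<phi> c"
    by simp
qed (simp add: kernel_ideal_def monomial_def push_diff)

lemma primeideal_kernel_ideal:
  assumes "\<And>x y. \<phi> (x + y) = \<phi> x + \<phi> y"
  shows "primeideal (kernel_ideal \<phi> :: ('k::field, 's::finite) mpol set) mpol_ring"
proof (rule primeidealI)
  show "ideal (kernel_ideal \<phi> :: ('k, 's) mpol set) mpol_ring"
    by (rule ideal_ring_of_type_algebraI) (auto simp: kernel_ideal_def push_add push_mult[OF assms])
  have "(1 :: ('k, 's) mpol) \<notin> kernel_ideal \<phi>"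
    by (simp add: kernel_ideal_def flip: single_one)
      (metis lookup_single_eq lookup_zero zero_neq_one)
  then show "carrier mpol_ring \<noteq> (kernel_ideal \<phi> :: ('k, 's) mpol set)"
    by auto
qed (auto simp: kernel_ideal_def push_mult[OF assms] intro: cring_from_type_algebra)

text \<open>The hypothesis makes \<open>\<psi>\<close> factor through \<open>\<phi>\<close>. The
  second factor comes from a choice of preimages and may fail to be additive, which
  \<open>push\<close> allows.\<close>

lemma kernel_ideal_mono:
  assumes "\<And>b c. \<phi> b = \<phi> c \<Longrightarrow> \<psi> b = \<psi> c"
  shows "kernel_ideal \<phi> \<subseteq> (kernel_ideal \<psi> :: ('k::field, 's::finite) mpol set)"
proof
  fix f :: "('k, 's) mpol" assume f: "f \<in> kernel_ideal \<phi>"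
  have "\<psi> c = \<psi> (inv_into UNIV \<phi> (\<phi> c))" for c
    by (rule assms) (simp add: f_inv_into_f)
  then have "\<psi> = (\<lambda>y. \<psi> (inv_into UNIV \<phi> y)) \<circ> \<phi>"
    by (simp only: fun_eq_iff o_apply) blast
  then have "push \<psi> f = push (\<lambda>y. \<psi> (inv_into UNIV \<phi> y)) (push \<phi> f)"
    by (simp only: push_push)
  then show "f \<in> kernel_ideal \<psi>"
    using f by (simp add: kernel_ideal_def)
qed

lemma lattice_ideal_subset_kernel_ideal:
  assumes "\<And>a. a \<in> L \<Longrightarrow> \<phi> (pos_part a) = \<phi> (neg_part a)"
    and "\<And>x y. \<phi> (x + y) = \<phi> x + \<phi> y"
  shows "lattice_ideal L \<subseteq> (kernel_ideal \<phi> :: ('k::field, 's::finite) mpol set)"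
proof -
  interpret ring "mpol_ring :: ('k, 's) mpol ring"
    by (rule ring_from_type_algebra)
  have "ideal (kernel_ideal \<phi> :: ('k, 's) mpol set) mpol_ring"
    using assms(2) by (intro primeideal.axioms(1) primeideal_kernel_ideal)
  then show ?thesis
    unfolding lattice_ideal_def
    by (rule genideal_minimal) (auto simp: binomial_in_kernel_ideal_iff assms)
qed

section \<open>Chains of primes in a quotient ring\<close>

context cring
begin

text \<open>Since \<open>J\<close> contains \<open>I\<close>, it is a union of cosets of
  \<open>I\<close>.\<close>

lemma rcoset_mem_image_iff:
  assumes "ideal I R" "ideal J R" "I \<subseteq> J" "x \<in> carrier R"
  shows "I +> x \<in> (+>) I ` J \<longleftrightarrow> x \<in> J"
proof
  interpret I: ideal I R by fact
  assume "I +> x \<in> (+>) I ` J"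
  then obtain y where y: "I +> x = I +> y" "y \<in> J"
    by (rule imageE)
  have "x \<in> I +> x"
    by (rule I.a_rcos_self[OF assms(4)])
  then have "x \<in> I +> y"
    by (simp only: y(1))
  then obtain i where i: "i \<in> I" "x = i \<oplus> y"
    by (auto simp: a_r_coset_def' intro: that)
  have "i \<oplus> y \<in> J"
    using y(2) i(1) assms(3) by (intro additive_subgroup.a_closed[OF ideal.axioms(1)[OF assms(2)]]) auto
  then show "x \<in> J"
    by (simp only: i(2))
qed (rule imageI)

text \<open>One direction of the correspondence between primes above \<open>I\<close> and primes of
  the quotient: a product in the image of \<open>J\<close> lifts to a product in
  \<open>J\<close>.\<close>

lemma primeideal_Quot:
  assumes I: "ideal I R" and J: "primeideal J R" and sub: "I \<subseteq> J"
  shows "primeideal ((+>) I ` J) (R Quot I)"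
proof -
  have J': "ideal J R"
    using J by (rule primeideal.axioms(1))
  note mem = rcoset_mem_image_iff[OF I J' sub]
  have surj: "carrier (R Quot I) = (+>) I ` carrier R"
    by (simp add: FactRing_def A_RCOSETS_def') blast
  show ?thesis
  proof (rule primeidealI)
    show "ideal ((+>) I ` J) (R Quot I)"
      by (rule ring_ideal_imp_quot_ideal[OF I J'])
    show "cring (R Quot I)"
      by (rule ideal.quotient_is_cring[OF I is_cring])
    have "\<one> \<notin> J"
      using ideal.one_imp_carrier[OF J'] primeideal.I_notcarr[OF J] by blast
    then have "I +> \<one> \<notin> (+>) I ` J"
      by (simp only: mem[OF one_closed] not_False_eq_True)
    then show "carrier (R Quot I) \<noteq> (+>) I ` J"
      unfolding surj using one_closed by blast
  next
    fix a b
    assume "a \<in> carrier (R Quot I)" "b \<in> carrier (R Quot I)" and ab: "a \<otimes>\<^bsub>R Quot I\<^esub> b \<in> (+>) I ` J"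
    then obtain x y where xy: "x \<in> carrier R" "y \<in> carrier R" "a = I +> x" "b = I +> y"
      unfolding surj by blast
    have "I +> (x \<otimes> y) = a \<otimes>\<^bsub>R Quot I\<^esub> b"
      unfolding xy(3,4) by (rule ring_hom_mult[OF ideal.rcos_ring_hom[OF I] xy(1,2)])
    then have "I +> (x \<otimes> y) \<in> (+>) I ` J"
      using ab by (simp only:)
    then have "x \<otimes> y \<in> J"
      by (simp only: mem[OF m_closed[OF xy(1,2)]])
    then have "x \<in> J \<or> y \<in> J"
      by (rule primeideal.I_prime[OF J xy(1,2)])
    then show "a \<in> (+>) I ` J \<or> b \<in> (+>) I ` J"
      unfolding xy(3,4) by blast
  qed
qed

text \<open>The chain is pushed to the quotient; it stays strict because an element outside
  \<open>P i\<close> has its coset outside the image of \<open>P i\<close>.\<close>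

lemma krull_dim_Quot_ge:
  assumes I: "ideal I R"
    and P: "\<And>i. i \<le> n \<Longrightarrow> primeideal (P i) R" "\<And>i. i \<le> n \<Longrightarrow> I \<subseteq> P i"
    and strict: "\<And>i. i < n \<Longrightarrow> P i \<subset> P (Suc i)"
  shows "enat n \<le> krull_dim (R Quot I)"
proof -
  have "(+>) I ` P i \<subset> (+>) I ` P (Suc i)" if i: "i < n" for i
  proof -
    obtain x where x: "x \<in> P (Suc i)" "x \<notin> P i"
      using strict[OF i] by blast
    have ideals: "ideal (P i) R" "ideal (P (Suc i)) R"
      using P(1)[of i] P(1)[of "Suc i"] i by (auto dest: primeideal.axioms(1))
    then have "x \<in> carrier R"
      using x ideal.Icarr by metis
    then have "I +> x \<notin> (+>) I ` P i"
      using rcoset_mem_image_iff[OF I ideals(1) P(2)] x i by simp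
    then show ?thesis
      using x strict[OF i] by blast
  qed
  then have "(\<forall>i\<le>n. primeideal ((+>) I ` P i) (R Quot I)) \<and> (\<forall>i<n. (+>) I ` P i \<subset> (+>) I ` P (Suc i))"
    using primeideal_Quot[OF I P] by blast
  then show ?thesis
    unfolding krull_dim_def by (intro Sup_upper CollectI exI[of _ n] conjI refl) (rule exI)
qed

end

section \<open>Linear algebra over the rationals and saturation\<close>

lemma exists_separating_functional:
  fixes c :: "'a::field ^ 'n"
  assumes "c \<notin> vec.span S"
  obtains e :: "'a ^ 'n \<Rightarrow> 'a"
  where "\<And>x y. e (x + y) = e x + e y" "\<And>x. x \<in> S \<Longrightarrow> e x = 0" "e c \<noteq> 0"
proof -
  obtain B0 where B0: "B0 \<subseteq> S" "vec.independent B0" "S \<subseteq> vec.span B0"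
    using vec.maximal_independent_subset by blast
  have span: "vec.span B0 = vec.span S"
    using B0 by (simp add: vec.span_eq vec.span_superset subset_trans)
  have c: "c \<notin> vec.span B0"
    using assms span by simp
  \<comment> \<open>The functional will be the coordinate at \<open>c\<close> for a basis extending
    \<open>insert c B0\<close>. It vanishes on \<open>S\<close> because elements of \<open>S\<close>
    are combinations of \<open>B0\<close>, which omits \<open>c\<close>.\<close>
  define B1 where "B1 = vec.extend_basis (insert c B0)"
  have ind: "vec.independent (insert c B0)"
    using B0 c by (rule_tac vec.independent_insertI)
  have B1: "vec.independent B1" "insert c B0 \<subseteq> B1" "vec.span B1 = UNIV"
    using vec.independent_extend_basis[OF ind] vec.extend_basis_superset[OF ind] vec.span_extend_basis[OF ind]
    by (simp_all add: B1_def)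
  define e where "e x = vec.representation B1 x c" for x
  show thesis
  proof (rule that)
    show "e (x + y) = e x + e y" for x y
      unfolding e_def using B1 by (simp add: vec.representation_add)
    show "e x = 0" if "x \<in> S" for x
    proof -
      have "vec.representation B1 x = vec.representation B0 x"
        using B0 B1 that by (intro vec.representation_extend) auto
      moreover have "c \<notin> B0"
        using c vec.span_base by blast
      ultimately show ?thesis
        unfolding e_def using vec.representation_ne_zero by metis
    qed
    show "e c \<noteq> 0"
      unfolding e_def using B1 by (simp add: vec.representation_basis)
  qed
qed

definition rat_vec :: "int ^ 's \<Rightarrow> rat ^ 's"
  where "rat_vec a = (\<chi> j. of_int (a $ j))"

lemma rat_vec_nth [simp]: "rat_vec a $ j = of_int (a $ j)"
  by (simp add: rat_vec_def)

lemma rat_vec_add: "rat_vec (a + b) = rat_vec a + rat_vec b"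
  by (simp add: vec_eq_iff)

text \<open>Clearing denominators: the rational vectors with a positive integer multiple in
  \<open>L\<close> form a subspace, which therefore contains the rational span of
  \<open>L\<close>.\<close>

lemma (in int_lattice) rat_vec_span:
  assumes "rat_vec c \<in> vec.span (rat_vec ` L)"
  shows "\<exists>n>0. n *s c \<in> L"
proof -
  let ?S = "{x. \<exists>n>0. \<exists>a\<in>L. of_int n *s x = rat_vec a}"
  have "vec.subspace ?S"
  proof (rule vec.subspaceI)
    show "0 \<in> ?S"
      using zero_mem by (auto intro!: exI[of _ 1] bexI[of _ 0] simp: vec_eq_iff)
  next
    fix x y assume "x \<in> ?S" "y \<in> ?S"
    then obtain m n a b where mn: "m > 0" "n > 0" "a \<in> L" "b \<in> L"
      "of_int m *s x = rat_vec a" "of_int n *s y = rat_vec b"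
      by blast
    have "of_int (m * n) *s (x + y) = rat_vec (n *s a + m *s b)"
      using mn(5,6) by (simp add: vec_eq_iff algebra_simps)
    then show "x + y \<in> ?S"
      using mn by (intro CollectI exI[of _ "m * n"] conjI bexI[of _ "n *s a + m *s b"])
        (simp_all add: add_mem smult_mem)
  next
    fix r x assume "x \<in> ?S"
    then obtain n a where n: "n > 0" "a \<in> L" "of_int n *s x = rat_vec a"
      by blast
    obtain p q where pq: "quotient_of r = (p, q)"
      by fastforce
    then have q: "q > 0" "r = of_int p / of_int q"
      by (simp_all add: quotient_of_denom_pos quotient_of_div)
    then have "of_int q * r = of_int p"
      by simp
    then have "of_int (n * q) *s (r *s x) = rat_vec (p *s a)"
      using n(3) by (simp add: vec_eq_iff mult.left_commute) (metis mult.assoc mult.commute)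
    then show "r *s x \<in> ?S"
      using n q by (intro CollectI exI[of _ "n * q"] conjI bexI[of _ "p *s a"]) (simp_all add: smult_mem)
  qed
  moreover have "rat_vec ` L \<subseteq> ?S"
    by (auto intro!: exI[of _ 1])
  ultimately have "vec.span (rat_vec ` L) \<subseteq> ?S"
    by (simp add: vec.span_minimal)
  then obtain n a where n: "n > 0" "a \<in> L" "of_int n *s rat_vec c = rat_vec a"
    using assms by blast
  then have "of_int (n * c $ j) = (of_int (a $ j) :: rat)" for j
    by (simp add: vec_eq_iff)
  then have "n *s c = a"
    by (simp add: vec_eq_iff del: of_int_mult)
  then show ?thesis
    using n by blast
qed

lemma (in int_lattice) saturation_of_krull_dim_one:
  fixes d :: "nat ^ 's"
  assumes dim: "krull_dim ((mpol_ring :: ('k::field, 's) mpol ring) Quot lattice_ideal L) = 1"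
    and d: "\<And>j. 0 < d $ j"
    and weight: "\<And>a. a \<in> L \<Longrightarrow> int_weight d a = 0"
    and c: "int_weight d c = 0"
  shows "\<exists>n>0. n *s c \<in> L"
proof (rule ccontr)
  assume "\<not> ?thesis"
  then have "rat_vec c \<notin> vec.span (rat_vec ` L)"
    using rat_vec_span by blast
  then obtain e :: "rat ^ 's \<Rightarrow> rat" where e: "\<And>x y. e (x + y) = e x + e y"
    "\<And>x. x \<in> rat_vec ` L \<Longrightarrow> e x = 0" "e (rat_vec c) \<noteq> 0"
    by (rule exists_separating_functional) (rule that)
  have "(\<rat> :: real set) \<noteq> UNIV"
    using uncountable_UNIV_real countable_rat by metis
  then obtain \<theta> :: real where irr: "\<theta> \<notin> \<rat>"
    by blast
  define \<epsilon> where "\<epsilon> b = e (rat_vec (int_vec b))" for b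
  have \<epsilon>_add: "\<epsilon> (x + y) = \<epsilon> x + \<epsilon> y" for x y
    by (simp add: \<epsilon>_def int_vec_add rat_vec_add e)
  have \<epsilon>_diff: "\<epsilon> (pos_part a) - \<epsilon> (neg_part a) = e (rat_vec a)" for a
  proof -
    have "int_vec (pos_part a) = a + int_vec (neg_part a)"
      using int_vec_pos_neg_part[of a] by (simp add: algebra_simps)
    then have "\<epsilon> (pos_part a) = e (rat_vec a) + \<epsilon> (neg_part a)"
      by (simp add: \<epsilon>_def rat_vec_add e)
    then show ?thesis
      by simp
  qed
  \<comment> \<open>\<open>\<phi> 0\<close> records both the weight and \<open>\<epsilon>\<close>,
    \<open>\<phi> 1\<close> only the weight, and \<open>\<phi> 2\<close> nothing. Coarser maps have
    larger kernels, which yields the chain of three primes.\<close>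
  define \<phi> where "\<phi> i b = (if i = 0 then real (weighted_degree d b) + \<theta> * of_rat (\<epsilon> b)
    else if i = 1 then real (weighted_degree d b) else 0)" for i :: nat and b
  have wd_add: "weighted_degree d (x + y) = weighted_degree d x + weighted_degree d y" for x y
    by (simp add: weighted_degree_def distrib_left sum.distrib)
  have \<phi>_add: "\<phi> i (x + y) = \<phi> i x + \<phi> i y" for i x y
    by (simp add: \<phi>_def wd_add \<epsilon>_add of_rat_add distrib_left)
  have wd_parts: "weighted_degree d (pos_part a) = weighted_degree d (neg_part a)" if "int_weight d a = 0" for a
    using that int_vec_pos_neg_part[of a] int_weight_diff[of d "int_vec (pos_part a)" "int_vec (neg_part a)"]
    by (simp add: int_weight_int_vec)
  have \<phi>_L: "\<phi> i (pos_part a) = \<phi> i (neg_part a)" if "a \<in> L" for i a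
    using wd_parts[OF weight[OF that]] \<epsilon>_diff[of a] e(2) that by (simp add: \<phi>_def)
  define P :: "nat \<Rightarrow> ('k, 's) mpol set" where "P i = kernel_ideal (\<phi> i)" for i
  have "P 0 \<subseteq> P 1"
    unfolding P_def
  proof (rule kernel_ideal_mono)
    fix b b' assume eq: "\<phi> 0 b = \<phi> 0 b'"
    then have *: "\<theta> * of_rat (\<epsilon> b - \<epsilon> b') = real (weighted_degree d b') - real (weighted_degree d b)"
      by (simp add: \<phi>_def of_rat_diff algebra_simps)
    \<comment> \<open>Otherwise the equation could be solved for \<open>\<theta>\<close>, which
      would then be rational.\<close>
    have "\<epsilon> b = \<epsilon> b'"
    proof (rule ccontr)
      assume "\<epsilon> b \<noteq> \<epsilon> b'"
      then have "\<theta> = (real (weighted_degree d b') - real (weighted_degree d b)) / of_rat (\<epsilon> b - \<epsilon> b')"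
        by (simp add: eq_divide_eq *)
      also have "\<dots> \<in> \<rat>"
        by (intro Rats_divide Rats_diff Rats_of_nat Rats_of_rat)
      finally show False
        using irr by simp
    qed
    then show "\<phi> 1 b = \<phi> 1 b'"
      using eq by (simp add: \<phi>_def)
  qed
  moreover have "P 0 \<noteq> P 1"
  proof -
    \<comment> \<open>The two exponents differ by \<open>c\<close>, which has weight 0 but is not
      killed by \<open>e\<close>.\<close>
    let ?f = "monomial (pos_part c) - monomial (neg_part c) :: ('k, 's) mpol"
    have "\<theta> \<noteq> 0"
      using irr by auto
    then have "\<phi> 0 (pos_part c) \<noteq> \<phi> 0 (neg_part c)"
      using \<epsilon>_diff[of c] e(3) wd_parts[OF c] by (auto simp: \<phi>_def)
    then have "?f \<notin> P 0"
      by (simp add: P_def binomial_in_kernel_ideal_iff)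
    moreover have "?f \<in> P 1"
      using wd_parts[OF c] by (simp add: P_def binomial_in_kernel_ideal_iff \<phi>_def)
    ultimately show ?thesis
      by blast
  qed
  moreover have "P 1 \<subseteq> P 2"
    unfolding P_def by (rule kernel_ideal_mono) (simp add: \<phi>_def)
  moreover have "P 1 \<noteq> P 2"
  proof -
    fix j :: 's
    \<comment> \<open>The polynomial t_j - 1 joins exponents of the distinct weights
      \<open>d $ j\<close> and 0.\<close>
    let ?f = "monomial (axis j 1) - monomial 0 :: ('k, 's) mpol"
    have "weighted_degree d (axis j 1) = d $ j" "weighted_degree d 0 = 0"
      by (simp_all add: weighted_degree_def axis_def if_distrib cong: if_cong)
    then have "?f \<notin> P 1"
      using d[of j] by (simp add: P_def binomial_in_kernel_ideal_iff \<phi>_def)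
    moreover have "?f \<in> P 2"
      by (simp add: P_def binomial_in_kernel_ideal_iff \<phi>_def)
    ultimately show ?thesis
      by blast
  qed
  ultimately have "P 0 \<subset> P 1" "P 1 \<subset> P 2"
    by blast+
  then have strict: "P i \<subset> P (Suc i)" if "i < 2" for i
    using less_2_cases[OF that] by (metis One_nat_def Suc_1)
  interpret cring "mpol_ring :: ('k, 's) mpol ring"
    by (rule cring_from_type_algebra)
  have "enat 2 \<le> krull_dim ((mpol_ring :: ('k, 's) mpol ring) Quot lattice_ideal L)"
  proof (rule krull_dim_Quot_ge[OF lattice_ideal_is_ideal])
    show "primeideal (P i) mpol_ring" for i
      unfolding P_def by (rule primeideal_kernel_ideal) (rule \<phi>_add)
    show "lattice_ideal L \<subseteq> P i" for i
      unfolding P_def by (rule lattice_ideal_subset_kernel_ideal) (auto simp: \<phi>_L \<phi>_add)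
  qed (rule strict)
  then show False
    by (simp add: dim one_enat_def)
qed

section \<open>The affine Hilbert function of the kernel of a push-forward\<close>

text \<open>Here \<open>P\<close> and \<open>W\<close> will be the polynomials of bounded degree in
  the ring and in the ideal. They are required to be subspaces rather than ideals, since a degree
  bound need not survive multiplication; multiplying by \<open>Poly_Mapping.single 0 a\<close> is
  scaling by \<open>a\<close>.\<close>

locale mpol_subquotient =
  fixes P W :: "('k::field, 's::finite) mpol set"
  assumes W_subset: "W \<subseteq> P"
    and P_zero: "0 \<in> P" and P_add: "\<And>f g. f \<in> P \<Longrightarrow> g \<in> P \<Longrightarrow> f + g \<in> P"
    and P_scale: "\<And>a f. f \<in> P \<Longrightarrow> Poly_Mapping.single 0 a * f \<in> P"
    and W_zero: "0 \<in> W" and W_add: "\<And>f g. f \<in> W \<Longrightarrow> g \<in> W \<Longrightarrow> f + g \<in> W"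
    and W_scale: "\<And>a f. f \<in> W \<Longrightarrow> Poly_Mapping.single 0 a * f \<in> W"
begin

definition Q :: "('k, ('k, 's) mpol set) module"
  where "Q = quotient_space (mpol_space\<lparr>carrier := P\<rparr>) W"

text \<open>The class map onto the quotient by \<open>W\<close>. The operations of \<open>Q\<close>
  are computed through it below.\<close>

definition q :: "('k, 's) mpol \<Rightarrow> ('k, 's) mpol set"
  where "q v = (\<lambda>w. w + v) ` W"

lemma uminus_eq_scale: "- f = Poly_Mapping.single 0 (- 1) * (f :: ('k, 's) mpol)"
  by (simp add: single_uminus)

lemma W_uminus: "f \<in> W \<Longrightarrow> - f \<in> W"
  unfolding uminus_eq_scale by (rule W_scale)

lemma P_uminus: "f \<in> P \<Longrightarrow> - f \<in> P"
  unfolding uminus_eq_scale by (rule P_scale)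

lemma W_diff: "f \<in> W \<Longrightarrow> g \<in> W \<Longrightarrow> f - g \<in> W"
  using W_add[of f "- g"] W_uminus by simp

lemma mem_q_iff: "x \<in> q v \<longleftrightarrow> x - v \<in> W"
  unfolding q_def by (auto intro: image_eqI[of _ _ "x - v"])

lemma q_eq_iff: "q u = q v \<longleftrightarrow> u - v \<in> W"
proof
  assume "q u = q v"
  moreover have "u \<in> q u"
    by (simp add: mem_q_iff W_zero)
  ultimately show "u - v \<in> W"
    by (simp add: mem_q_iff)
next
  assume uv: "u - v \<in> W"
  have "x - u \<in> W \<longleftrightarrow> x - v \<in> W" for x
    using W_add[OF _ uv, of "x - u"] W_diff[OF _ uv, of "x - v"] by auto
  then show "q u = q v"
    by (auto simp: mem_q_iff)
qed

lemma space_simps: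
  "carrier (mpol_space\<lparr>carrier := P\<rparr>) = P"
  "x \<oplus>\<^bsub>mpol_space\<lparr>carrier := P\<rparr>\<^esub> y = x + y"
  "a \<odot>\<^bsub>mpol_space\<lparr>carrier := P\<rparr>\<^esub> x = Poly_Mapping.single 0 a * x"
  by (simp_all add: mpol_space_def ring.defs mult_map_scale_conv_mult)

lemma coset_eq_q: "W +>\<^bsub>mpol_space\<lparr>carrier := P\<rparr>\<^esub> v = q v"
  unfolding a_r_coset_def' q_def space_simps by blast

lemma carrier_Q: "carrier Q = q ` P"
  by (simp add: Q_def quotient_space_def ring.defs FactRing_def A_RCOSETS_def' coset_eq_q)
    (simp add: mpol_space_def ring.defs UNION_singleton_eq_range)

lemma zero_Q: "\<zero>\<^bsub>Q\<^esub> = q 0"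
  by (simp add: Q_def quotient_space_def ring.defs FactRing_def q_def)

lemma add_Q: "q u \<oplus>\<^bsub>Q\<^esub> q v = q (u + v)"
proof -
  have "q u \<oplus>\<^bsub>Q\<^esub> q v = (\<Union>x\<in>q u. \<Union>y\<in>q v. {x + y})"
    by (simp add: Q_def quotient_space_def ring.defs FactRing_def set_add_def' space_simps)
      (simp add: mpol_space_def ring.defs)
  also have "\<dots> = q (u + v)"
  proof (intro equalityI subsetI)
    fix z assume "z \<in> (\<Union>x\<in>q u. \<Union>y\<in>q v. {x + y})"
    then obtain x y where "x - u \<in> W" "y - v \<in> W" "z = x + y"
      by (auto simp: mem_q_iff)
    then show "z \<in> q (u + v)"
      using W_add[of "x - u" "y - v"] by (simp add: mem_q_iff algebra_simps)
  next
    fix z assume "z \<in> q (u + v)"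
    then have "z - v \<in> q u" "v \<in> q v" "z = (z - v) + v"
      by (simp_all add: mem_q_iff algebra_simps W_zero)
    then show "z \<in> (\<Union>x\<in>q u. \<Union>y\<in>q v. {x + y})"
      by blast
  qed
  finally show ?thesis .
qed

lemma smult_Q: "a \<odot>\<^bsub>Q\<^esub> q v = q (Poly_Mapping.single 0 a * v)"
proof -
  have "a \<odot>\<^bsub>Q\<^esub> q v = (\<Union>x\<in>q v. q (Poly_Mapping.single 0 a * x))"
    by (simp add: Q_def quotient_space_def ring.defs FactRing_def coset_eq_q space_simps)
      (simp add: mpol_space_def ring.defs mult_map_scale_conv_mult)
  \<comment> \<open>All members of the union are the same class: elements of \<open>q v\<close>
    differ by elements of \<open>W\<close>, and so do their multiples.\<close>
  also have "\<dots> = (\<Union>x\<in>q v. q (Poly_Mapping.single 0 a * v))"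
    by (intro SUP_cong refl) (simp add: q_eq_iff mem_q_iff W_scale flip: right_diff_distrib)
  also have "\<dots> = q (Poly_Mapping.single 0 a * v)"
    using W_zero by (auto simp: q_def)
  finally show ?thesis .
qed

lemma vectorspace_Q: "vectorspace (ring_of_type_algebra :: 'k ring) Q"
proof -
  have abel: "abelian_group Q"
  proof (rule abelian_groupI)
    fix x assume "x \<in> carrier Q"
    then obtain u where u: "u \<in> P" "x = q u"
      by (auto simp: carrier_Q)
    then have "q (- u) \<in> carrier Q" "q (- u) \<oplus>\<^bsub>Q\<^esub> x = \<zero>\<^bsub>Q\<^esub>"
      by (auto simp: carrier_Q add_Q zero_Q P_uminus)
    then show "\<exists>y\<in>carrier Q. y \<oplus>\<^bsub>Q\<^esub> x = \<zero>\<^bsub>Q\<^esub>"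
      by blast
  qed (auto simp: carrier_Q add_Q zero_Q P_zero P_add add_ac)
  show ?thesis
  proof (intro vectorspace.intro moduleI)
    show "abelian_group Q"
      by (rule abel)
    show "Ring.field (ring_of_type_algebra :: 'k ring)"
      by (rule field_from_type_algebra)
    show "cring (ring_of_type_algebra :: 'k ring)"
      by (rule cring_from_type_algebra)
  qed (auto simp: carrier_Q smult_Q add_Q P_scale single_add distrib_right distrib_left
      mult.assoc[symmetric] mult_single)
qed

lemma finsum_q:
  assumes "\<And>x. x \<in> A \<Longrightarrow> h x \<in> P"
  shows "finsum Q (\<lambda>x. q (h x)) A = q (sum h A)"
proof -
  interpret Q: vectorspace "ring_of_type_algebra :: 'k ring" Q
    by (rule vectorspace_Q)
  show ?thesis
    using assms
  proof (induction A rule: infinite_finite_induct)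
    case (infinite A)
    then show ?case
      by (simp add: finsum_def finprod_def zero_Q)
  next
    case empty
    then show ?case
      by (simp add: zero_Q)
  next
    case (insert x A)
    then show ?case
      by (subst Q.finsum_insert) (auto simp: carrier_Q add_Q)
  qed
qed

end

text \<open>Modulo the kernel, a polynomial of degree at most \<open>i\<close> is determined by its
  push-forward. Choosing one monomial of degree at most \<open>i\<close> over each value of
  \<open>\<phi>\<close> gives a basis of the quotient.\<close>

lemma affine_hilbert_function_eq_card:
  fixes \<phi> :: "nat ^ 's::finite \<Rightarrow> 'c"
  defines "I \<equiv> {f :: ('k::field, 's) mpol. push \<phi> f = 0}"
  assumes finite: "finite (\<phi> ` {c. (\<Sum>j\<in>UNIV. c $ j) \<le> i})"
  shows "affine_hilbert_function I i = card (\<phi> ` {c. (\<Sum>j\<in>UNIV. c $ j) \<le> i})"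
proof -
  let ?P = "polys_upto i :: ('k, 's) mpol set" and ?W = "I \<inter> polys_upto i"
  let ?D = "{c :: nat ^ 's. (\<Sum>j\<in>UNIV. c $ j) \<le> i}"
  have P_iff: "f \<in> ?P \<longleftrightarrow> Poly_Mapping.keys f \<subseteq> ?D" for f
    by (auto simp: polys_upto_def)
  have scale: "push \<phi> (Poly_Mapping.single 0 a * f) = 0" if "push \<phi> f = 0" for a and f :: "('k, 's) mpol"
  proof -
    have "push \<phi> (Poly_Mapping.single 0 a * f) = Poly_Mapping.map ((*) a) 0"
      using that by (simp add: push_single_mult)
    also have "\<dots> = 0"
      by (rule map_scale_zero)
    finally show ?thesis .
  qed
  have keys_scale: "Poly_Mapping.keys (Poly_Mapping.single 0 a * f) \<subseteq> Poly_Mapping.keys f" for a and f :: "('k, 's) mpol"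
    by (auto simp: in_keys_iff Poly_Mapping.map.rep_eq when_def simp flip: mult_map_scale_conv_mult split: if_splits)
  interpret mpol_subquotient ?P ?W
  proof
    show "f + g \<in> ?P" if "f \<in> ?P" "g \<in> ?P" for f g
      using that Poly_Mapping.keys_add[of f g] by (auto simp: P_iff)
    then show "f + g \<in> ?W" if "f \<in> ?W" "g \<in> ?W" for f g
      using that by (simp add: I_def push_add)
    show "Poly_Mapping.single 0 a * f \<in> ?P" if "f \<in> ?P" for a f
      using that keys_scale[of a f] by (auto simp: P_iff)
    then show "Poly_Mapping.single 0 a * f \<in> ?W" if "f \<in> ?W" for a f
      using that by (simp add: I_def scale)
  qed (auto simp: P_iff I_def)
  interpret Q: vectorspace "ring_of_type_algebra :: 'k ring" Q
    by (rule vectorspace_Q)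
  \<comment> \<open>The preimage is chosen inside \<open>?D\<close>, so that the representing
    monomial respects the degree bound.\<close>
  define \<rho> where "\<rho> = inv_into ?D \<phi>"
  have \<rho>: "\<rho> y \<in> ?D" "\<phi> (\<rho> y) = y" if "y \<in> \<phi> ` ?D" for y
    unfolding \<rho>_def using that by (rule inv_into_into, rule f_inv_into_f)
  define b where "b y = q (Poly_Mapping.single (\<rho> y) 1)" for y
  define B where "B = b ` \<phi> ` ?D"
  have single_P: "Poly_Mapping.single (\<rho> y) a \<in> ?P" if "y \<in> \<phi> ` ?D" for y a
    using \<rho>(1)[OF that] by (simp add: P_iff)
  have q_eq: "q f = q g \<longleftrightarrow> push \<phi> f = push \<phi> g" if "f \<in> ?P" "g \<in> ?P" for f g
  proof -
    have "f - g \<in> ?P"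
      using P_add[OF that(1) P_uminus[OF that(2)]] by simp
    then show ?thesis
      unfolding q_eq_iff by (simp add: I_def push_diff)
  qed
  have inj: "inj_on b (\<phi> ` ?D)"
  proof (rule inj_onI)
    fix y z assume y: "y \<in> \<phi> ` ?D" and z: "z \<in> \<phi> ` ?D" and "b y = b z"
    then have "Poly_Mapping.single y (1 :: 'k) = Poly_Mapping.single z 1"
      by (simp only: b_def q_eq[OF single_P[OF y] single_P[OF z]] push_single \<rho>)
    then have "Poly_Mapping.keys (Poly_Mapping.single y (1 :: 'k)) = Poly_Mapping.keys (Poly_Mapping.single z (1 :: 'k))"
      by (simp only:)
    then show "y = z"
      by simp
  qed
  have lincomb: "Q.lincomb a (b ` Y) = q (\<Sum>y\<in>Y. Poly_Mapping.single (\<rho> y) (a (b y)))"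
    if Y: "Y \<subseteq> \<phi> ` ?D" for a Y
  proof -
    have "Q.lincomb a (b ` Y) = finsum Q (\<lambda>y. a (b y) \<odot>\<^bsub>Q\<^esub> b y) Y"
      unfolding Q.lincomb_def
    proof (rule Q.finsum_reindex)
      show "inj_on b Y"
        using inj Y by (rule inj_on_subset)
      show "(\<lambda>v. a v \<odot>\<^bsub>Q\<^esub> v) \<in> b ` Y \<rightarrow> carrier Q"
        using Y single_P by (auto simp: b_def smult_Q carrier_Q mult_single)
    qed
    also have "(\<lambda>y. a (b y) \<odot>\<^bsub>Q\<^esub> b y) = (\<lambda>y. q (Poly_Mapping.single (\<rho> y) (a (b y))))"
      by (rule ext) (simp add: b_def smult_Q mult_single)
    also have "finsum Q \<dots> Y = q (\<Sum>y\<in>Y. Poly_Mapping.single (\<rho> y) (a (b y)))"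
      using Y single_P by (intro finsum_q) auto
    finally show ?thesis .
  qed
  have sum_P: "(\<Sum>y\<in>Y. Poly_Mapping.single (\<rho> y) (h y)) \<in> ?P" if "Y \<subseteq> \<phi> ` ?D" for Y h
    using that by (induction Y rule: infinite_finite_induct) (auto simp: P_zero intro!: P_add single_P)
  have push_sum_single: "push \<phi> (\<Sum>y\<in>Y. Poly_Mapping.single (\<rho> y) (h y)) = (\<Sum>y\<in>Y. Poly_Mapping.single y (h y))"
    if "Y \<subseteq> \<phi> ` ?D" for Y and h :: "'c \<Rightarrow> 'k"
    unfolding push_sum push_single using that by (intro sum.cong refl) (auto simp: \<rho>(2))
  have "Q.basis B"
    unfolding Q.basis_def
  proof (intro conjI)
    show B_carrier: "B \<subseteq> carrier Q"
      using single_P by (auto simp: B_def b_def carrier_Q)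
    show "Q.lin_indpt B"
      unfolding Q.lin_dep_def
    proof clarify
      fix A a v
      assume A: "A \<subseteq> B" and zero: "Q.lincomb a A = \<zero>\<^bsub>Q\<^esub>" and v: "v \<in> A"
        and av: "a v \<noteq> \<zero>\<^bsub>(ring_of_type_algebra :: 'k ring)\<^esub>"
      obtain Y where Y: "Y \<subseteq> \<phi> ` ?D" "A = b ` Y"
        using A unfolding B_def by (rule subset_imageE) (rule that)
      obtain y where y: "y \<in> Y" "v = b y"
        using v Y by blast
      \<comment> \<open>Applying \<open>push \<phi>\<close> turns the vanishing combination into a
        sum of terms with distinct exponents \<open>y\<close>, from which each coefficient can be
        read off.\<close>
      have "q (\<Sum>y\<in>Y. Poly_Mapping.single (\<rho> y) (a (b y))) = q 0"
        using zero by (simp only: Y(2) lincomb[OF Y(1)] zero_Q)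
      then have "(\<Sum>y\<in>Y. Poly_Mapping.single y (a (b y))) = 0"
        by (simp only: q_eq[OF sum_P[OF Y(1)] P_zero] push_sum_single[OF Y(1)] push_zero)
      moreover have "Poly_Mapping.lookup (\<Sum>y\<in>Y. Poly_Mapping.single y (a (b y))) y = a (b y)"
        using y(1) finite_subset[OF Y(1) finite] by (simp add: lookup_sum lookup_single when_def)
      ultimately show False
        using av y(2) by simp
    qed
    show "Q.gen_set B"
    proof
      show "Q.span B \<subseteq> carrier Q"
        using B_carrier by (rule Q.span_is_subset2)
      show "carrier Q \<subseteq> Q.span B"
      proof
        fix x assume "x \<in> carrier Q"
        then obtain f where f: "f \<in> ?P" "x = q f"
          by (auto simp: carrier_Q)
        \<comment> \<open>The coordinates of the class of \<open>f\<close> are the coefficients of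
          its push-forward, transported to basis vectors by inverting \<open>b\<close>.\<close>
        define a where "a x = Poly_Mapping.lookup (push \<phi> f) (inv_into (\<phi> ` ?D) b x)" for x
        have ab: "a (b y) = Poly_Mapping.lookup (push \<phi> f) y" if "y \<in> \<phi> ` ?D" for y
          unfolding a_def using inj that by simp
        have "Poly_Mapping.keys (push \<phi> f) \<subseteq> \<phi> ` ?D"
          using keys_push[of \<phi> f] f(1) unfolding P_iff by blast
        then have "push id (push \<phi> f) = (\<Sum>y\<in>\<phi> ` ?D. Poly_Mapping.single (id y) (Poly_Mapping.lookup (push \<phi> f) y))"
          by (rule push_superset[OF finite])
        also have "\<dots> = (\<Sum>y\<in>\<phi> ` ?D. Poly_Mapping.single y (a (b y)))"
          by (intro sum.cong refl) (simp only: ab id_apply)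
        also have "\<dots> = push \<phi> (\<Sum>y\<in>\<phi> ` ?D. Poly_Mapping.single (\<rho> y) (a (b y)))"
          by (simp only: push_sum_single[OF subset_refl])
        finally have "x = q (\<Sum>y\<in>\<phi> ` ?D. Poly_Mapping.single (\<rho> y) (a (b y)))"
          by (simp only: f(2) q_eq[OF f(1) sum_P[OF subset_refl]] push_id)
        then have "x = Q.lincomb a B"
          by (simp only: B_def lincomb[OF subset_refl])
        moreover have "finite B"
          unfolding B_def using finite by (rule finite_imageI)
        ultimately show "x \<in> Q.span B"
          unfolding Q.span_def by (intro CollectI exI[of _ a] exI[of _ B]) simp
      qed
    qed
  qed
  moreover have "finite B"
    unfolding B_def using finite by (rule finite_imageI)
  ultimately have "Q.dim = card B"
    by (intro Q.dim_basis)
  also have "card B = card (\<phi> ` ?D)"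
    unfolding B_def by (rule card_image[OF inj])
  finally show ?thesis
    by (simp only: affine_hilbert_function_def Q_def)
qed

section \<open>Degree and torsion\<close>

lemma comm_group_int_lattice_group: "comm_group (int_lattice_group :: (int ^ 's::finite) monoid)"
  by (rule comm_groupI) (auto simp: int_lattice_group_def add_ac intro: exI[of _ "- x" for x])

lemma inv_int_lattice_group: "inv\<^bsub>int_lattice_group\<^esub> a = - a"
proof -
  interpret comm_group "int_lattice_group :: (int ^ 's) monoid"
    by (rule comm_group_int_lattice_group)
  show ?thesis
    by (rule inv_equality) (simp_all add: int_lattice_group_def)
qed

lemma int_lattice_of_subgroup:
  assumes "subgroup L int_lattice_group"
  shows "int_lattice L"
proof
  show "0 \<in> L"
    using subgroup.one_closed[OF assms] by (simp add: int_lattice_group_def)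
  show "a + b \<in> L" if "a \<in> L" "b \<in> L" for a b
    using subgroup.m_closed[OF assms that] by (simp add: int_lattice_group_def)
  show "- a \<in> L" if "a \<in> L" for a
    using subgroup.m_inv_closed[OF assms that] by (simp add: inv_int_lattice_group)
qed

text \<open>The power of a coset with exponent \<open>n\<close> is the coset of the
  \<open>n\<close>-fold multiple, and it is trivial exactly when that multiple lies in
  \<open>L\<close>.\<close>

lemma torsion_subgroup_Mod:
  assumes "subgroup L int_lattice_group"
  shows "torsion_subgroup (int_lattice_group Mod L) = coset L ` {a. \<exists>n>0. n *s a \<in> L}"
proof -
  interpret int_lattice L
    by (rule int_lattice_of_subgroup[OF assms])
  interpret G: comm_group "int_lattice_group :: (int ^ 's) monoid"
    by (rule comm_group_int_lattice_group)
  interpret normal L int_lattice_group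
    by (rule G.subgroup_imp_normal[OF assms])
  interpret M: group "int_lattice_group Mod L"
    by (rule factorgroup_is_group)
  let ?M = "int_lattice_group Mod L"
  have rcos: "L #>\<^bsub>int_lattice_group\<^esub> a = coset L a" for a
    by (auto simp: r_coset_def coset_def int_lattice_group_def algebra_simps
        intro!: bexI[of _ "x - a" for x])
  have carrier: "carrier ?M = range (coset L)"
    by (auto simp: FactGroup_def RCOSETS_def rcos) (auto simp: int_lattice_group_def)
  have one: "\<one>\<^bsub>?M\<^esub> = coset L 0"
    by (simp add: FactGroup_def coset_def)
  have mult: "coset L a \<otimes>\<^bsub>?M\<^esub> coset L b = coset L (a + b)" for a b
    using rcos_sum[of a b] by (simp add: FactGroup_def rcos) (simp add: int_lattice_group_def)
  have pow: "coset L a [^]\<^bsub>?M\<^esub> n = coset L (int n *s a)" for a and n :: nat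
  proof (induction n)
    case (Suc n)
    have "int n *s a + a = int (Suc n) *s a"
      by (simp add: vec_eq_iff distrib_right)
    then show ?case
      using Suc mult by simp
  qed (simp add: coset_def)
  have ex_int: "(\<exists>n>0. int n *s a \<in> L) \<longleftrightarrow> (\<exists>n>0. n *s a \<in> L)" for a
    using pos_int_cases by (metis of_nat_0_less_iff)
  have "torsion_subgroup ?M = coset L ` {a. \<exists>n>0. int n *s a \<in> L}"
    unfolding torsion_subgroup_def carrier one by (auto simp: pow coset_eq_iff intro!: imageI)
  then show ?thesis
    by (simp only: ex_int)
qed

text \<open>Induction over sets of coordinates. Each new coordinate combines the old gcd with one
  more entry by a Bezout pair, scaling the old coefficients by \<open>q\<close>.\<close>

lemma bezout_vec: "\<exists>u. int_weight d u = int (GCD j. d $ j)"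
proof -
  have "\<exists>u. (\<Sum>j\<in>A. int (d $ j) * u j) = int (Gcd (($) d ` A))" if "finite A" for A
    using that
  proof (induction A)
    case (insert x A)
    then obtain u where u: "(\<Sum>j\<in>A. int (d $ j) * u j) = int (Gcd (($) d ` A))"
      by blast
    obtain p q where pq: "p * int (d $ x) + q * int (Gcd (($) d ` A)) = gcd (int (d $ x)) (int (Gcd (($) d ` A)))"
      using bezout_int by blast
    define v where "v j = (if j = x then p else q * u j)" for j
    have "(\<Sum>j\<in>A. int (d $ j) * v j) = (\<Sum>j\<in>A. q * (int (d $ j) * u j))"
      using insert by (intro sum.cong) (auto simp: v_def)
    also have "\<dots> = q * int (Gcd (($) d ` A))"
      by (simp add: u flip: sum_distrib_left)
    finally have "(\<Sum>j\<in>insert x A. int (d $ j) * v j) = int (Gcd (($) d ` insert x A))"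
      using insert pq by (simp add: v_def gcd_int_int_eq mult.commute)
    then show ?case
      by blast
  qed simp
  then obtain u where "(\<Sum>j\<in>UNIV. int (d $ j) * u j) = int (Gcd (range (($) d)))"
    using finite by blast
  then have "int_weight d (vec_lambda u) = int (GCD j. d $ j)"
    by (simp add: int_weight_def)
  then show ?thesis
    by blast
qed

text \<open>If the two monomials of the binomial of \<open>a\<close> had different weights, one of
  them would be a homogeneous component and so lie in the ideal. A single monomial never does,
  because its coefficient 1 is the sum over its coset.\<close>

lemma (in int_lattice) weight_mem_of_homogeneous:
  assumes hom: "homogeneous_ideal d (lattice_ideal L :: ('k::field, 's) mpol set)" and a: "a \<in> L"
  shows "int_weight d a = 0"
proof (rule ccontr)
  let ?f = "monomial (pos_part a) - monomial (neg_part a) :: ('k, 's) mpol"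
  let ?n = "weighted_degree d (pos_part a)"
  assume "int_weight d a \<noteq> 0"
  then have neq: "?n \<noteq> weighted_degree d (neg_part a)"
    using int_weight_diff[of d "int_vec (pos_part a)" "int_vec (neg_part a)"]
    by (auto simp: int_weight_int_vec int_vec_pos_neg_part)
  then have parts: "pos_part a \<noteq> neg_part a"
    by auto
  have lookup: "Poly_Mapping.lookup ?f (pos_part a) = 1"
    using parts by (simp add: monomial_def lookup_minus lookup_single when_def)
  have keys: "c = pos_part a \<or> c = neg_part a" if "c \<in> Poly_Mapping.keys ?f" for c
    using that by (auto simp: in_keys_iff monomial_def lookup_minus lookup_single when_def split: if_splits)
  have "{c \<in> Poly_Mapping.keys ?f. weighted_degree d c = ?n} = {pos_part a}"
  proof (intro equalityI subsetI)
    fix c assume "c \<in> {c \<in> Poly_Mapping.keys ?f. weighted_degree d c = ?n}"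
    then show "c \<in> {pos_part a}"
      using keys[of c] neq by auto
  qed (simp add: in_keys_iff lookup)
  then have "homogeneous_component d ?n ?f = monomial (pos_part a)"
    by (simp add: homogeneous_component_def lookup) (simp add: monomial_def)
  moreover have "?f \<in> lattice_ideal L"
    by (rule binomial_in_lattice_ideal[OF a])
  then have "homogeneous_component d ?n ?f \<in> lattice_ideal L"
    using hom unfolding homogeneous_ideal_def by blast
  ultimately have "monomial (pos_part a) \<in> (lattice_ideal L :: ('k, 's) mpol set)"
    by simp
  then have "Poly_Mapping.single (coset L (int_vec (pos_part a))) (1 :: 'k) = 0"
    by (simp add: mem_lattice_ideal_iff monomial_def)
  then show False
    by (metis lookup_single_eq lookup_zero zero_neq_one)
qed

theorem corollary4p9:
  fixes L :: "(int ^ 's::finite) set"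
    and d :: "nat ^ 's"
    and I :: "('k::field, 's) mpol set"
  assumes "subgroup L int_lattice_group"
    and "I = lattice_ideal L"
    and "krull_dim (mpol_ring Quot I) = 1"
    and "\<forall>j. 0 < d $ j"
    and "homogeneous_ideal d I"
  shows "real (GCD j. d $ j) * quotient_degree I
       = real (MAX j. d $ j) * real (card (torsion_subgroup (int_lattice_group Mod L)))"
proof -
  interpret int_lattice L
    by (rule int_lattice_of_subgroup[OF assms(1)])
  have I: "I = {f. push (\<lambda>c. coset L (int_vec c)) f = 0}"
    using assms(2) by (auto simp: mem_lattice_ideal_iff)
  have weight: "int_weight d a = 0" if "a \<in> L" for a
    using assms(2,5) that by (auto intro: weight_mem_of_homogeneous)
  have sat: "\<exists>n>0. n *s a \<in> L" if "int_weight d a = 0" for a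
    by (rule saturation_of_krull_dim_one[OF _ _ weight that]) (use assms in auto)
  define g where "g = (GCD j. d $ j)"
  \<comment> \<open>Dividing by the gcd makes the weight map surjective onto the integers.\<close>
  define w where "w = (\<chi> j. d $ j div g)"
  have dvd: "g dvd d $ j" for j
    by (auto simp: g_def)
  have d: "d $ j = g * w $ j" for j
    using dvd[of j] by (simp add: w_def)
  have g: "g > 0"
    using assms(4) d by (metis mult_is_0 neq0_conv)
  have weight_d: "int_weight d a = int g * int_weight w a" for a
    by (simp add: int_weight_def d sum_distrib_left mult.assoc)
  interpret graded_lattice L w
  proof
    show "0 < w $ j" for j
      using assms(4) d by (metis mult_is_0 neq0_conv)
    show "int_weight w a = 0" if "a \<in> L" for a
      using weight[OF that] g by (simp add: weight_d)
    obtain u where "int_weight d u = int g"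
      using bezout_vec[of d] by (auto simp: g_def)
    then show "\<exists>u. int_weight w u = 1"
      using g by (auto simp: weight_d)
    show "\<exists>n>0. n *s a \<in> L" if "int_weight w a = 0" for a
      using sat that by (simp add: weight_d)
  qed
  have torsion: "torsion_subgroup (int_lattice_group Mod L) = fiber 0"
  proof -
    \<comment> \<open>Weight 0 is necessary because a positive multiple has weight 0, and sufficient
      by saturation.\<close>
    have "(\<exists>n>0. n *s a \<in> L) \<longleftrightarrow> int_weight w a = 0" for a
      using saturation weight_mem by (metis int_weight_smult less_irrefl mult_eq_0_iff)
    then show ?thesis
      by (simp add: torsion_subgroup_Mod[OF assms(1)] fiber_def)
  qed
  have max: "(MAX j. d $ j) = g * max_weight"
  proof -
    have "(MAX j. d $ j) = Max ((*) g ` range (($) w))"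
      by (simp add: image_image d)
    also have "\<dots> = g * Max (range (($) w))"
      by (rule mono_Max_commute[symmetric]) (auto intro: monoI)
    finally show ?thesis
      by (simp add: max_weight_def)
  qed
  have hilbert: "affine_hilbert_function I i = card (hit i)" for i
  proof -
    have "finite ((\<lambda>c. coset L (int_vec c)) ` {c. (\<Sum>j\<in>UNIV. c $ j) \<le> i})"
      using finite_hit[of i] by (simp add: hit_def)
    then show ?thesis
      unfolding I hit_def by (rule affine_hilbert_function_eq_card)
  qed
  \<comment> \<open>In dimension 1 the factorial is 1 and the normalizing power is \<open>i\<close>
    itself.\<close>
  have "quotient_degree I = lim (\<lambda>i. real (card (hit i)) / real i)"
    by (simp add: quotient_degree_def assms(3) hilbert one_enat_def Let_def)
  also have "\<dots> = real max_weight * real (card (fiber 0))"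
    by (rule limI) (rule hit_asymptotics)
  finally show ?thesis
    by (simp add: max torsion flip: g_def)
qed

end
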